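(* Let $\mathcal{G}$ be the AMP Markov equivalence class of a chain graph and let $\mathcal{G}^*$ be its AMP essential graph. Then $\mathcal{G}^*$ is adicyclic (i.e., is a chain graph) and $\mathcal{G}^*\in\mathcal{G}$.
   Context: All graphs are finite; between two distinct vertices there is at most one edge, which is either a line (undirected edge) $a-b$ or an arrow $a\to b$. $a\Rightarrow b$ means $a\to b$ or $a-b$; $a\cdots b$ means $a,b$ are adjacent. A $k$-cycle ($k\ge 3$) is a sequence $(v_0,\dots,v_k=v_0)$, with $v_0,\dots,v_{k-1}$ distinct, such that $v_{i-1}\Rightarrow v_i$ for all $i=1,\dots,k$; it is semi-directed if at least one of these edges is an arrow. A graph is adicyclic if it has no semi-directed cycles; a chain graph (CG) is an adicyclic graph. The skeleton of a graph is the undirected graph obtained by forgetting the orientation of arrows. A triplex $(\{a,c\},b)$ occurs in a graph if $a,c$ are nonadjacent and the induced subgraph on $\{a,b,c\}$ is $a\to b\leftarrow c$ (an immorality), or $a\to b-c$ or $a-b\leftarrow c$ (flags). Two CGs with the same vertex set are AMP Markov equivalent if they determine the same set of distributions under the AMP (alternative) Markov property; by a known theorem of Andersson, Madigan and Perlman this holds iff they have the same skeleton and the same triplexes, which may be taken as the definition. $\mathcal{G}$ is the set of all CGs AMP Markov equivalent to a fixed but arbitrary CG $G_0$ with vertex set $V$. The AMP essential graph $\mathcal{G}^*$ has vertex set $V$ and the same skeleton as $G_0$. An arrow $a\to b$ occurs in $\mathcal{G}^*$ iff $a\to b\in G$ for at least one $G\in\mathcal{G}$ but $a\leftarrow b\in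 G'$ for no $G'\in\mathcal{G}$. A line $a-b$ occurs in $\mathcal{G}^*$ iff either $a-b\in G$ for every $G\in\mathcal{G}$, or there exist $G,G'\in\mathcal{G}$ with $a\to b\in G$ and $a\leftarrow b\in G'$. *)

theory Defs
  imports Main
begin

text \<open>
  A graph may have both arrows (ordered pairs of vertices) and lines (two-element sets of vertices).
\<close>

record 'a graph =
  verts :: "'a set"
  arrows :: "('a \<times> 'a) set"
  lines :: "'a set set"

abbreviation arrow :: "'a \<Rightarrow> 'a graph \<Rightarrow> 'a \<Rightarrow> bool" ("_ \<rightarrow>\<^bsub>_\<^esub> _" [51, 0, 51] 50) where
  "a \<rightarrow>\<^bsub>G\<^esub> b \<equiv> (a, b) \<in> arrows G"

abbreviation line :: "'a \<Rightarrow> 'a graph \<Rightarrow> 'a \<Rightarrow> bool" ("_ \<midarrow>\<^bsub>_\<^esub> _" [51, 0, 51] 50) where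
  "a \<midarrow>\<^bsub>G\<^esub> b \<equiv> {a, b} \<in> lines G"

definition adjacent :: "'a graph \<Rightarrow> 'a \<Rightarrow> 'a \<Rightarrow> bool" where
  "adjacent G a b \<longleftrightarrow> a \<rightarrow>\<^bsub>G\<^esub> b \<or> b \<rightarrow>\<^bsub>G\<^esub> a \<or> a \<midarrow>\<^bsub>G\<^esub> b"

definition is_graph :: "'a graph \<Rightarrow> bool" where
  "is_graph G \<longleftrightarrow>
     finite (verts G) \<and>
     arrows G \<subseteq> {(a, b). a \<in> verts G \<and> b \<in> verts G \<and> a \<noteq> b} \<and>
     lines G \<subseteq> {{a, b} |a b. a \<in> verts G \<and> b \<in> verts G \<and> a \<noteq> b} \<and>
     (\<forall>a b. a \<rightarrow>\<^bsub>G\<^esub> b \<longrightarrow> \<not> b \<rightarrow>\<^bsub>G\<^esub> a \<and> \<not> a \<midarrow>\<^bsub>G\<^esub> b)"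

definition is_cycle :: "'a graph \<Rightarrow> nat \<Rightarrow> (nat \<Rightarrow> 'a) \<Rightarrow> bool" where
  "is_cycle G k v \<longleftrightarrow>
     3 \<le> k \<and> v k = v 0 \<and> inj_on v {..<k} \<and>
     (\<forall>i\<in>{1..k}. v (i - 1) \<rightarrow>\<^bsub>G\<^esub> v i \<or> v (i - 1) \<midarrow>\<^bsub>G\<^esub> v i)"

definition semi_directed_cycle :: "'a graph \<Rightarrow> nat \<Rightarrow> (nat \<Rightarrow> 'a) \<Rightarrow> bool" where
  "semi_directed_cycle G k v \<longleftrightarrow> is_cycle G k v \<and> (\<exists>i\<in>{1..k}. v (i - 1) \<rightarrow>\<^bsub>G\<^esub> v i)"

definition adicyclic :: "'a graph \<Rightarrow> bool" where
  "adicyclic G \<longleftrightarrow> (\<nexists>k v. semi_directed_cycle G k v)"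

definition chain_graph :: "'a graph \<Rightarrow> bool" where
  "chain_graph G \<longleftrightarrow> is_graph G \<and> adicyclic G"

definition skeleton :: "'a graph \<Rightarrow> 'a graph" where
  "skeleton G = \<lparr>verts = verts G, arrows = {}, lines = lines G \<union> {{a, b} |a b. a \<rightarrow>\<^bsub>G\<^esub> b}\<rparr>"

text \<open>
  The condition \<open>a \<noteq> c\<close> is needed: no vertex is adjacent to itself, so nonadjacency does
  not imply distinctness.
\<close>

definition triplexes :: "'a graph \<Rightarrow> ('a set \<times> 'a) set" where
  "triplexes G =
     {({a, c}, b) |a b c. a \<noteq> c \<and> \<not> adjacent G a c \<and>
        (a \<rightarrow>\<^bsub>G\<^esub> b \<and> c \<rightarrow>\<^bsub>G\<^esub> b \<or>
         a \<rightarrow>\<^bsub>G\<^esub> b \<and> b \<midarrow>\<^bsub>G\<^esub> c \<or>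
         a \<midarrow>\<^bsub>G\<^esub> b \<and> c \<rightarrow>\<^bsub>G\<^esub> b)}"

text \<open>
  Markov equivalence with respect to the AMP (alternative) Markov property, in its graphical form
  (Andersson, Madigan and Perlman).
\<close>

definition amp_equivalent :: "'a graph \<Rightarrow> 'a graph \<Rightarrow> bool" where
  "amp_equivalent G H \<longleftrightarrow> skeleton G = skeleton H \<and> triplexes G = triplexes H"

definition amp_class :: "'a graph \<Rightarrow> 'a graph set" where
  "amp_class G0 = {G. chain_graph G \<and> amp_equivalent G G0}"

definition essential_graph :: "'a graph \<Rightarrow> 'a graph" where
  "essential_graph G0 =
     \<lparr>verts = verts G0,
      arrows = {(a, b). (\<exists>G\<in>amp_class G0. a \<rightarrow>\<^bsub>G\<^esub> b) \<and> \<not> (\<exists>G'\<in>amp_class G0. b \<rightarrow>\<^bsub>G'\<^esub> a)},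
      lines = {{a, b} |a b. (\<forall>G\<in>amp_class G0. a \<midarrow>\<^bsub>G\<^esub> b) \<or>
                            (\<exists>G\<in>amp_class G0. \<exists>G'\<in>amp_class G0. a \<rightarrow>\<^bsub>G\<^esub> b \<and> b \<rightarrow>\<^bsub>G'\<^esub> a)}\<rparr>"

lemma lines_ex: "e \<in> lines G \<Longrightarrow> chain_graph G \<Longrightarrow> \<exists>a b. e = {a,b} \<and> a \<noteq> b"
  unfolding chain_graph_def is_graph_def by blast

lemma adj_skel: "adjacent G a b \<longleftrightarrow> {a,b} \<in> lines (skeleton G)"
  unfolding adjacent_def skeleton_def by (auto simp: doubleton_eq_iff)

text \<open>
  That the essential graph has the same skeleton as \<open>G0\<close> need not be stipulated, as it follows
  from the conditions on arrows and lines.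
\<close>

lemma skeleton_essential_graph:
  assumes "chain_graph G0"
  shows "skeleton (essential_graph G0) = skeleton G0"
proof -
  have G0: "G0 \<in> amp_class G0" using assms by (simp add: amp_class_def amp_equivalent_def)
  have adj: "adjacent G a b \<longleftrightarrow> adjacent G0 a b" if "G \<in> amp_class G0" for G a b
    using that by (simp add: amp_class_def amp_equivalent_def adj_skel)
  have E: "a \<midarrow>\<^bsub>essential_graph G0\<^esub> b \<longleftrightarrow> (\<forall>G\<in>amp_class G0. a \<midarrow>\<^bsub>G\<^esub> b) \<or>
      (\<exists>G\<in>amp_class G0. \<exists>G'\<in>amp_class G0. a \<rightarrow>\<^bsub>G\<^esub> b \<and> b \<rightarrow>\<^bsub>G'\<^esub> a)" for a b
    by (auto simp: essential_graph_def doubleton_eq_iff insert_commute)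
  have A: "adjacent (essential_graph G0) a b \<longleftrightarrow> adjacent G0 a b" for a b
  proof -
    have "a \<rightarrow>\<^bsub>essential_graph G0\<^esub> b \<longleftrightarrow> 
       (\<exists>G\<in>amp_class G0. a \<rightarrow>\<^bsub>G\<^esub> b) \<and> \<not> (\<exists>G'\<in>amp_class G0. b \<rightarrow>\<^bsub>G'\<^esub> a)" for a b
      by (simp add: essential_graph_def)
    then show ?thesis using adj[of _ a b] G0 unfolding adjacent_def E by metis
  qed
  have "e \<in> lines (skeleton (essential_graph G0)) \<longleftrightarrow> e \<in> lines (skeleton G0)" for e
  proof -
    have "\<exists>a b. e = {a,b}" if "e \<in> lines (skeleton (essential_graph G0)) \<or> e \<in> lines (skeleton G0)"
      using that lines_ex[of e G0] assms by (auto simp: skeleton_def essential_graph_def)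
    then show ?thesis using A adj_skel by metis
  qed
  then have "lines (skeleton (essential_graph G0)) = lines (skeleton G0)" by blast
  then show ?thesis by (simp add: skeleton_def essential_graph_def)
qed

end

theory Submission
  imports Defs "HOL-Library.Product_Lexorder"
begin

text \<open>
  Write \<open>E\<close> for the essential graph. That \<open>E\<close> is a graph with the right skeleton and the right
  triplexes is a local matter: a triplex at \<open>b\<close> in one member of the class is a triplex in every
  member and so forbids arrows out of \<open>b\<close> everywhere. The work is in showing that \<open>E\<close> is adicyclic.

  A shortest semi-directed cycle of \<open>E\<close> of length at least four has no chords. If a member \<open>G\<close>
  has one arrow of it, then, since consecutive edges are unshielded and triplexes are shared, \<open>G\<close>
  is forced edge by edge to follow the whole cycle (\<open>unshielded_step\<close>), which is absurd. Among
  triangles, comparing two members excludes all but \<open>a \<rightarrow> b\<close>, \<open>b \<midarrow> c\<close>, \<open>c \<midarrow> a\<close> in which both lines are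
  reversible, that is, directed both ways by members. Then there is a member with \<open>c \<rightarrow> a \<rightarrow> b\<close> and
  one with \<open>a \<rightarrow> b \<rightarrow> c\<close>, and \<open>a \<rightarrow> b\<close> must be shown to be reversible as well.

  Two operations stay inside the class. Refinement (\<open>refine_mem\<close>) replaces the lines of one member by
  whatever another member has in their place; so every member can be refined, keeping its arrows, to
  one whose lines are exactly those common to the whole class. All these finest members have the
  same lines, hence the same line components, and differ only by reversals of arrows. If an arrow
  between two components is reversed, then all arrows between them are, and the two components
  together form a clique. Such members therefore behave like acyclic directed graphs
  on the components, and the second operation is the analogue of reversing a covered arrow of such a
  graph: flip all arrows from one component to another when both have the same further parents
  (\<open>finest_flip_closed\<close>). As long as two finest members differ, some flip brings them closer
  (\<open>covered_if_extremal\<close>).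

  Now take finest members \<open>G\<close> with \<open>c \<rightarrow> a \<rightarrow> b\<close> and \<open>H\<close> with \<open>a \<rightarrow> b \<rightarrow> c\<close> that differ in as few pairs
  of components as possible. A flip that brings them closer must destroy this configuration, so in
  \<open>G\<close> it can only flip the arrow \<open>c \<rightarrow> a\<close>, and in \<open>H\<close> only \<open>b \<rightarrow> c\<close>. This rigidity determines the parents of \<open>a\<close>
  and \<open>c\<close> so far that there is a reversed arrow \<open>c \<rightarrow> y\<close> with \<open>a \<rightarrow> y\<close> covered
  (\<open>next_reversed_head\<close>, \<open>covered_a_next\<close>). Flipping \<open>a \<rightarrow> y\<close> and then \<open>c \<rightarrow> y\<close> gives a pair that is again
  minimal but in which \<open>y \<rightarrow> a\<close> is reversed, against the same rigidity (\<open>no_witness\<close>).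
\<close>

section \<open>Chain graphs and rank functions\<close>

definition steps :: "'a graph \<Rightarrow> ('a \<times> 'a) set" where
  "steps G = {(a, b). a \<rightarrow>\<^bsub>G\<^esub> b \<or> a \<midarrow>\<^bsub>G\<^esub> b}"

lemma line_sym: "a \<midarrow>\<^bsub>G\<^esub> b \<longleftrightarrow> b \<midarrow>\<^bsub>G\<^esub> a"
  by (simp add: insert_commute)

lemma adjacent_sym: "adjacent G a b \<longleftrightarrow> adjacent G b a"
  unfolding adjacent_def using line_sym by metis

lemma is_graphD:
  assumes "is_graph G"
  shows "finite (verts G)"
    and "a \<rightarrow>\<^bsub>G\<^esub> b \<Longrightarrow> a \<in> verts G \<and> b \<in> verts G \<and> a \<noteq> b"
    and "a \<midarrow>\<^bsub>G\<^esub> b \<Longrightarrow> a \<in> verts G \<and> b \<in> verts G \<and> a \<noteq> b"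
    and "a \<rightarrow>\<^bsub>G\<^esub> b \<Longrightarrow> \<not> b \<rightarrow>\<^bsub>G\<^esub> a"
    and "a \<rightarrow>\<^bsub>G\<^esub> b \<Longrightarrow> \<not> a \<midarrow>\<^bsub>G\<^esub> b"
proof -
  show "finite (verts G)" "a \<rightarrow>\<^bsub>G\<^esub> b \<Longrightarrow> a \<in> verts G \<and> b \<in> verts G \<and> a \<noteq> b"
    "a \<rightarrow>\<^bsub>G\<^esub> b \<Longrightarrow> \<not> b \<rightarrow>\<^bsub>G\<^esub> a" "a \<rightarrow>\<^bsub>G\<^esub> b \<Longrightarrow> \<not> a \<midarrow>\<^bsub>G\<^esub> b"
    using assms unfolding is_graph_def by blast+
  assume "a \<midarrow>\<^bsub>G\<^esub> b"
  then obtain x y where "{a, b} = {x, y}" "x \<in> verts G" "y \<in> verts G" "x \<noteq> y"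
    using assms unfolding is_graph_def by blast
  then show "a \<in> verts G \<and> b \<in> verts G \<and> a \<noteq> b"
    by (metis doubleton_eq_iff)
qed

lemma is_graphI:
  assumes "finite (verts G)"
    and "\<And>a b. a \<rightarrow>\<^bsub>G\<^esub> b \<Longrightarrow> a \<in> verts G \<and> b \<in> verts G \<and> a \<noteq> b"
    and "\<And>e. e \<in> lines G \<Longrightarrow> \<exists>a b. e = {a, b} \<and> a \<in> verts G \<and> b \<in> verts G \<and> a \<noteq> b"
    and "\<And>a b. a \<rightarrow>\<^bsub>G\<^esub> b \<Longrightarrow> \<not> b \<rightarrow>\<^bsub>G\<^esub> a \<and> \<not> a \<midarrow>\<^bsub>G\<^esub> b"
  shows "is_graph G"
  using assms unfolding is_graph_def by auto

text \<open>
  A shortest walk back from \<open>b\<close> to \<open>a\<close> repeats no vertex, and has at least two edges because the only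
  edge between \<open>a\<close> and \<open>b\<close> is the arrow; so it closes up with \<open>a \<rightarrow> b\<close> to a semi-directed cycle. From here
  on walks replace cycles.
\<close>

lemma no_closed_walk:
  assumes "chain_graph G" "a \<rightarrow>\<^bsub>G\<^esub> b"
  shows "(b, a) \<notin> (steps G)\<^sup>*"
proof
  assume "(b, a) \<in> (steps G)\<^sup>*"
  then have ex: "\<exists>n. (b, a) \<in> steps G ^^ n" by (simp add: rtrancl_power)
  define n where "n = (LEAST n. (b, a) \<in> steps G ^^ n)"
  have n: "(b, a) \<in> steps G ^^ n" unfolding n_def using ex by (rule LeastI_ex)
  have least: "n \<le> m" if "(b, a) \<in> steps G ^^ m" for m
    unfolding n_def using that by (rule Least_le)
  obtain p where p: "p 0 = b" "p n = a" "\<And>i. i < n \<Longrightarrow> (p i, p (Suc i)) \<in> steps G"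
    using n unfolding relpow_fun_conv by blast
  have sub: "(p i, p j) \<in> steps G ^^ (j - i)" if "i \<le> j" "j \<le> n" for i j
    unfolding relpow_fun_conv using that p(3)
    by (intro exI[of _ "\<lambda>k. p (i + k)"]) auto
  have inj: "p i \<noteq> p j" if "i < j" "j \<le> n" for i j
  proof
    assume eq: "p i = p j"
    have "(b, p j) \<in> steps G ^^ i" using sub[of 0 i] that p eq by simp
    moreover have "(p j, a) \<in> steps G ^^ (n - j)" using sub[of j n] that p by simp
    ultimately have "(b, a) \<in> steps G ^^ (i + (n - j))"
      unfolding relpow_add by blast
    then show False using least that by fastforce
  qed
  have gr: "is_graph G" using assms(1) by (simp add: chain_graph_def)
  have n2: "2 \<le> n"
  proof (rule ccontr)
    assume "\<not> 2 \<le> n"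
    then consider "n = 0" | "n = 1" by linarith
    then show False
    proof cases
      case 1
      then show False using p is_graphD(2)[OF gr assms(2)] by simp
    next
      case 2
      then have "(b, a) \<in> steps G" using n by simp
      then show False using is_graphD(4,5)[OF gr assms(2)] by (auto simp: steps_def insert_commute)
    qed
  qed
  define v where "v = (\<lambda>i. if i = 0 then a else p (i - 1))"
  have st: "(v (i - 1), v i) \<in> steps G" if "i \<in> {1..Suc n}" for i
  proof (cases "i = 1")
    case True
    then show ?thesis using assms(2) p by (simp add: v_def steps_def)
  next
    case False
    then have "i = Suc (Suc (i - 2))" "i - 2 < n" using that by auto
    then obtain k where "i = Suc (Suc k)" "k < n" by blast
    then show ?thesis using p(3)[of k] by (simp add: v_def)
  qed
  have "inj_on v {..<Suc n}"
  proof (rule linorder_inj_onI)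
    fix i j assume "i < j" "i \<in> {..<Suc n}" "j \<in> {..<Suc n}"
    then show "v i \<noteq> v j"
      using inj[of "i - 1" "j - 1"] inj[of "j - 1" n] p(2) by (cases "i = 0"; force simp: v_def)
  qed auto
  moreover have "v 0 \<rightarrow>\<^bsub>G\<^esub> v 1" using assms(2) p by (simp add: v_def)
  ultimately have "semi_directed_cycle G (Suc n) v"
    unfolding semi_directed_cycle_def is_cycle_def
    using st n2 p by (auto simp: steps_def v_def intro!: bexI[of _ 1])
  then show False using assms(1) unfolding chain_graph_def adicyclic_def by blast
qed

lemma adicyclicI:
  assumes "\<And>a b. a \<rightarrow>\<^bsub>G\<^esub> b \<Longrightarrow> (b, a) \<notin> (steps G)\<^sup>*"
  shows "adicyclic G"
  unfolding adicyclic_def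
proof (intro notI, elim exE)
  fix k v assume "semi_directed_cycle G k v"
  then obtain i where i: "i \<in> {1..k}" "v (i - 1) \<rightarrow>\<^bsub>G\<^esub> v i" and vk: "v k = v 0"
    and st: "\<And>j. j \<in> {1..k} \<Longrightarrow> (v (j - 1), v j) \<in> steps G"
    unfolding semi_directed_cycle_def is_cycle_def steps_def by auto
  have walk: "(v j, v m) \<in> (steps G)\<^sup>*" if "j \<le> m" "m \<le> k" for j m
    using that
  proof (induction m rule: dec_induct)
    case (step m)
    then show ?case using st[of "Suc m"] by (auto intro: rtrancl_into_rtrancl)
  qed simp
  have "(v i, v k) \<in> (steps G)\<^sup>*" "(v 0, v (i - 1)) \<in> (steps G)\<^sup>*"
    using walk i(1) by auto
  then have "(v i, v (i - 1)) \<in> (steps G)\<^sup>*" using vk by (metis rtrancl_trans)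
  then show False using assms[OF i(2)] by blast
qed

text \<open>
  The values are taken in an arbitrary order so that lexicographic ranks can be used for graphs
  that are composed from others.
\<close>

lemma adicyclic_if_ranked:
  fixes r :: "'a \<Rightarrow> 'b :: order"
  assumes "\<And>a b. a \<rightarrow>\<^bsub>G\<^esub> b \<Longrightarrow> r a < r b" "\<And>a b. a \<midarrow>\<^bsub>G\<^esub> b \<Longrightarrow> r a = r b"
  shows "adicyclic G"
proof (rule adicyclicI)
  fix a b assume ab: "a \<rightarrow>\<^bsub>G\<^esub> b"
  have "r x \<le> r y" if "(x, y) \<in> (steps G)\<^sup>*" for x y
    using that
  proof induction
    case (step y z)
    then have "r y \<le> r z" using assms unfolding steps_def by (auto intro: less_imp_le)
    then show ?case using step by (meson order_trans)
  qed simp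
  then show "(b, a) \<notin> (steps G)\<^sup>*" using assms(1)[OF ab] by (metis leD)
qed

text \<open>
  Counting the vertices from which \<open>v\<close> can be reached makes the criterion above
  a characterization of chain graphs.
\<close>

definition rank :: "'a graph \<Rightarrow> 'a \<Rightarrow> nat" where
  "rank G v = card {u. (u, v) \<in> (steps G)\<^sup>*}"

lemma rank_less:
  assumes "chain_graph G" "a \<rightarrow>\<^bsub>G\<^esub> b"
  shows "rank G a < rank G b"
  unfolding rank_def
proof (rule psubset_card_mono)
  have gr: "is_graph G" using assms(1) by (simp add: chain_graph_def)
  have "u \<in> insert b (verts G)" if "(u, b) \<in> (steps G)\<^sup>*" for u
    using that by (rule converse_rtranclE) (auto simp: steps_def dest: is_graphD(2,3)[OF gr])
  then have "{u. (u, b) \<in> (steps G)\<^sup>*} \<subseteq> insert b (verts G)" by blast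
  then show "finite {u. (u, b) \<in> (steps G)\<^sup>*}"
    using is_graphD(1)[OF gr] by (meson finite_insert finite_subset)
  have "(a, b) \<in> (steps G)\<^sup>*" using assms(2) by (auto simp: steps_def)
  then have "{u. (u, a) \<in> (steps G)\<^sup>*} \<subseteq> {u. (u, b) \<in> (steps G)\<^sup>*}"
    by (auto intro: rtrancl_trans)
  moreover have "b \<notin> {u. (u, a) \<in> (steps G)\<^sup>*}" using no_closed_walk[OF assms] by simp
  ultimately show "{u. (u, a) \<in> (steps G)\<^sup>*} \<subset> {u. (u, b) \<in> (steps G)\<^sup>*}" by blast
qed

lemma rank_line:
  assumes "a \<midarrow>\<^bsub>G\<^esub> b"
  shows "rank G a = rank G b"
proof -
  have "(a, b) \<in> steps G" "(b, a) \<in> steps G" using assms by (auto simp: steps_def insert_commute)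
  then have "(u, a) \<in> (steps G)\<^sup>* \<longleftrightarrow> (u, b) \<in> (steps G)\<^sup>*" for u
    by (meson rtrancl_into_rtrancl)
  then show ?thesis by (simp add: rank_def)
qed

lemma triangle_arrow:
  assumes "chain_graph G" "adjacent G x z"
    and "x \<rightarrow>\<^bsub>G\<^esub> y \<and> y \<rightarrow>\<^bsub>G\<^esub> z \<or> x \<rightarrow>\<^bsub>G\<^esub> y \<and> y \<midarrow>\<^bsub>G\<^esub> z \<or> x \<midarrow>\<^bsub>G\<^esub> y \<and> y \<rightarrow>\<^bsub>G\<^esub> z"
  shows "x \<rightarrow>\<^bsub>G\<^esub> z"
proof -
  have "rank G x < rank G z"
    using assms(3) rank_less[OF assms(1), of x y] rank_less[OF assms(1), of y z]
      rank_line[of x y G] rank_line[of y z G] by auto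
  then show ?thesis using assms(2) rank_less[OF assms(1), of z x] rank_line[of x z G]
    unfolding adjacent_def by auto
qed

section \<open>Markov equivalence\<close>

definition triplex :: "'a graph \<Rightarrow> 'a \<Rightarrow> 'a \<Rightarrow> 'a \<Rightarrow> bool" where
  "triplex G a b c \<longleftrightarrow> a \<noteq> c \<and> \<not> adjacent G a c \<and>
     (a \<rightarrow>\<^bsub>G\<^esub> b \<and> c \<rightarrow>\<^bsub>G\<^esub> b \<or> a \<rightarrow>\<^bsub>G\<^esub> b \<and> b \<midarrow>\<^bsub>G\<^esub> c \<or> a \<midarrow>\<^bsub>G\<^esub> b \<and> c \<rightarrow>\<^bsub>G\<^esub> b)"

lemma triplex_sym: "triplex G a b c \<longleftrightarrow> triplex G c b a"
  unfolding triplex_def using adjacent_sym[of G] line_sym[of _ _ G] by metis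

lemma mem_triplexes: "({a, c}, b) \<in> triplexes G \<longleftrightarrow> triplex G a b c"
proof
  assume "({a, c}, b) \<in> triplexes G"
  then obtain a' c' where "{a, c} = {a', c'}" "triplex G a' b c'"
    unfolding triplexes_def triplex_def by blast
  then show "triplex G a b c" using triplex_sym by (metis doubleton_eq_iff)
qed (unfold triplexes_def triplex_def, blast)

lemma amp_equivalent_iff:
  assumes "is_graph G" "is_graph H"
  shows "amp_equivalent G H \<longleftrightarrow> verts G = verts H \<and> (\<forall>a b. adjacent G a b \<longleftrightarrow> adjacent H a b) \<and>
    (\<forall>a b c. triplex G a b c \<longleftrightarrow> triplex H a b c)"
proof -
  have pair: "\<exists>a b. e = {a, b}" if "e \<in> lines (skeleton K)" "is_graph K" for e and K :: "'a graph"
    using that unfolding skeleton_def is_graph_def by auto blast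
  have "skeleton G = skeleton H \<longleftrightarrow>
      verts G = verts H \<and> (\<forall>e. e \<in> lines (skeleton G) \<longleftrightarrow> e \<in> lines (skeleton H))"
    by (auto simp: skeleton_def)
  also have "\<dots> \<longleftrightarrow> verts G = verts H \<and> (\<forall>a b. adjacent G a b \<longleftrightarrow> adjacent H a b)"
    unfolding adj_skel using pair assms by metis
  finally have sk: "skeleton G = skeleton H \<longleftrightarrow>
      verts G = verts H \<and> (\<forall>a b. adjacent G a b \<longleftrightarrow> adjacent H a b)" .
  have shape: "\<exists>a c b. t = ({a, c}, b)" if "t \<in> triplexes K" for t and K :: "'a graph"
    using that unfolding triplexes_def by blast
  have "triplexes G = triplexes H \<longleftrightarrow> (\<forall>a b c. triplex G a b c \<longleftrightarrow> triplex H a b c)"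
    unfolding mem_triplexes[symmetric] using shape by (metis subsetI subset_antisym)
  then show ?thesis using sk unfolding amp_equivalent_def by blast
qed

section \<open>Refining the lines of a chain graph\<close>

definition refine :: "'a graph \<Rightarrow> 'a graph \<Rightarrow> 'a graph" where
  "refine G H = \<lparr>verts = verts G, arrows = arrows G \<union> {(a, b). a \<midarrow>\<^bsub>G\<^esub> b \<and> a \<rightarrow>\<^bsub>H\<^esub> b},
     lines = lines G \<inter> lines H\<rparr>"

lemma refine_simps [simp]:
  "verts (refine G H) = verts G"
  "a \<rightarrow>\<^bsub>refine G H\<^esub> b \<longleftrightarrow> a \<rightarrow>\<^bsub>G\<^esub> b \<or> a \<midarrow>\<^bsub>G\<^esub> b \<and> a \<rightarrow>\<^bsub>H\<^esub> b"
  "e \<in> lines (refine G H) \<longleftrightarrow> e \<in> lines G \<and> e \<in> lines H"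
  by (auto simp: refine_def)

text \<open>
  The lexicographic combination of the two ranks is a rank: only ties in \<open>G\<close>, that is lines, are
  broken by \<open>H\<close>.
\<close>

lemma refine_chain_graph:
  assumes G: "chain_graph G" and H: "chain_graph H"
  shows "chain_graph (refine G H)"
  unfolding chain_graph_def
proof
  have gG: "is_graph G" and gH: "is_graph H" using assms by (auto simp: chain_graph_def)
  show "is_graph (refine G H)"
  proof (rule is_graphI)
    fix e assume "e \<in> lines (refine G H)"
    then show "\<exists>a b. e = {a, b} \<and> a \<in> verts (refine G H) \<and> b \<in> verts (refine G H) \<and> a \<noteq> b"
      using gG unfolding is_graph_def by auto
  next
    fix a b assume "a \<rightarrow>\<^bsub>refine G H\<^esub> b"
    then show "\<not> b \<rightarrow>\<^bsub>refine G H\<^esub> a \<and> \<not> a \<midarrow>\<^bsub>refine G H\<^esub> b"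
      using is_graphD(4,5)[OF gG] is_graphD(4,5)[OF gH] line_sym[of a b G] by auto
  qed (use is_graphD(1,2,3)[OF gG] in auto)
  show "adicyclic (refine G H)"
  proof (rule adicyclic_if_ranked[where r = "\<lambda>v. (rank G v, rank H v)"])
    fix a b assume "a \<rightarrow>\<^bsub>refine G H\<^esub> b"
    then show "(rank G a, rank H a) < (rank G b, rank H b)"
      using rank_less[OF G, of a b] rank_less[OF H, of a b] rank_line[of a b G] by auto
  next
    fix a b assume "a \<midarrow>\<^bsub>refine G H\<^esub> b"
    then show "(rank G a, rank H a) = (rank G b, rank H b)"
      using rank_line[of a b G] rank_line[of a b H] by simp
  qed
qed

text \<open>
  If both edges at \<open>b\<close> are lines of \<open>G\<close>, then \<open>H\<close> decides about both of them, and it has the same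
  triplexes. Otherwise \<open>G\<close> has an arrow there. For a triplex it suffices that refinement creates no
  arrow out of \<open>b\<close>, and \<open>H\<close> has none; for a nontriplex it suffices that \<open>G\<close> has an arrow
  out of \<open>b\<close>, which is kept.
\<close>

lemma refine_amp_equivalent:
  assumes G: "chain_graph G" and H: "chain_graph H" and eq: "amp_equivalent G H"
  shows "amp_equivalent (refine G H) G"
proof -
  have gG: "is_graph G" and gH: "is_graph H" and gK: "is_graph (refine G H)"
    using assms refine_chain_graph by (auto simp: chain_graph_def)
  have adjH: "adjacent G a b \<longleftrightarrow> adjacent H a b" and trH: "triplex G a b c \<longleftrightarrow> triplex H a b c" for a b c
    using eq amp_equivalent_iff[OF gG gH] by auto
  have adj: "adjacent (refine G H) a b \<longleftrightarrow> adjacent G a b" for a b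
    using adjH[of a b] line_sym[of a b G] unfolding adjacent_def by auto
  have shared: "\<not> b \<rightarrow>\<^bsub>H\<^esub> c" if "triplex G a b c" for a b c
  proof -
    have "triplex H a b c" using that trH by simp
    then show ?thesis using is_graphD(4,5)[OF gH, of b c] unfolding triplex_def by blast
  qed
  have keep: "triplex (refine G H) a b c" if t: "triplex G a b c" for a b c
  proof -
    have "\<not> b \<rightarrow>\<^bsub>H\<^esub> c" "\<not> b \<rightarrow>\<^bsub>H\<^esub> a" using shared t triplex_sym[of G a b c] by blast+
    then show ?thesis
      using t adj[of a c] adjH[of a b] adjH[of b c] line_sym[of a b G] line_sym[of b c G]
      unfolding triplex_def adjacent_def[of _ a b] adjacent_def[of _ b c] refine_simps by blast
  qed
  have reflect: "triplex G a b c" if t: "triplex (refine G H) a b c" for a b c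
  proof (cases "a \<midarrow>\<^bsub>G\<^esub> b \<and> b \<midarrow>\<^bsub>G\<^esub> c")
    case True
    then have "triplex H a b c"
      using t is_graphD(5)[OF gG, of a b] is_graphD(5)[OF gG, of c b] line_sym[of b c G]
        adj[of a c] adjH[of a c]
      unfolding triplex_def refine_simps by auto
    then show ?thesis using trH by simp
  next
    case False
    then show ?thesis
      using t adj[of a c] line_sym[of a b G] line_sym[of b c G]
      unfolding triplex_def refine_simps by blast
  qed
  have "triplex (refine G H) a b c \<longleftrightarrow> triplex G a b c" for a b c
    using keep reflect by blast
  then show ?thesis using adj amp_equivalent_iff[OF gK gG] by simp
qed

section \<open>Flipping the arrows between two components\<close>

definition flip :: "'a graph \<Rightarrow> 'a set \<Rightarrow> 'a set \<Rightarrow> 'a graph" where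
  "flip G X Y = G\<lparr>arrows := (arrows G - X \<times> Y) \<union> Y \<times> X\<rparr>"

lemma flip_simps [simp]:
  "verts (flip G X Y) = verts G"
  "a \<rightarrow>\<^bsub>flip G X Y\<^esub> b \<longleftrightarrow> a \<rightarrow>\<^bsub>G\<^esub> b \<and> \<not> (a \<in> X \<and> b \<in> Y) \<or> a \<in> Y \<and> b \<in> X"
  "lines (flip G X Y) = lines G"
  by (auto simp: flip_def)

text \<open>
  For singletons in an acyclic directed graph this is the usual notion of a covered arrow: head and
  tail have the same other parents. The fourth conjunct says that \<open>X\<close> and \<open>Y\<close> are line components
  and cliques.
\<close>

definition covered :: "'a graph \<Rightarrow> 'a set \<Rightarrow> 'a set \<Rightarrow> bool" where
  "covered G X Y \<longleftrightarrow>
     X \<noteq> {} \<and> Y \<noteq> {} \<and>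
     (\<forall>x\<in>X. \<forall>y\<in>Y. x \<rightarrow>\<^bsub>G\<^esub> y) \<and>
     (\<forall>S\<in>{X, Y}. \<forall>x\<in>S. \<forall>z. x \<midarrow>\<^bsub>G\<^esub> z \<longleftrightarrow> z \<in> S \<and> z \<noteq> x) \<and>
     (\<forall>z. z \<notin> X \<union> Y \<longrightarrow> (\<forall>x\<in>X. \<forall>y\<in>Y. z \<rightarrow>\<^bsub>G\<^esub> x \<longleftrightarrow> z \<rightarrow>\<^bsub>G\<^esub> y))"

lemma coveredD:
  assumes "covered G X Y"
  shows "X \<noteq> {}" "Y \<noteq> {}"
    "x \<in> X \<Longrightarrow> y \<in> Y \<Longrightarrow> x \<rightarrow>\<^bsub>G\<^esub> y"
    "x \<in> X \<Longrightarrow> x \<midarrow>\<^bsub>G\<^esub> z \<longleftrightarrow> z \<in> X \<and> z \<noteq> x"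
    "y \<in> Y \<Longrightarrow> y \<midarrow>\<^bsub>G\<^esub> z \<longleftrightarrow> z \<in> Y \<and> z \<noteq> y"
    "z \<notin> X \<Longrightarrow> z \<notin> Y \<Longrightarrow> x \<in> X \<Longrightarrow> y \<in> Y \<Longrightarrow> z \<rightarrow>\<^bsub>G\<^esub> x \<longleftrightarrow> z \<rightarrow>\<^bsub>G\<^esub> y"
  using assms unfolding covered_def by auto

text \<open>
  A rank for the flipped graph places \<open>Y\<close> directly before \<open>X\<close>, the vertices that can be reached
  from \<open>X \<union> Y\<close> after both, and all others before both. As \<open>X\<close> and \<open>Y\<close> have the
  same other parents, no walk that has left \<open>X \<union> Y\<close> can return to it.
\<close>

lemma flip_chain_graph:
  assumes G: "chain_graph G" and cov: "covered G X Y"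
  shows "chain_graph (flip G X Y)"
  unfolding chain_graph_def
proof
  have g: "is_graph G" using G by (simp add: chain_graph_def)
  note c = coveredD[OF cov]
  show "is_graph (flip G X Y)"
  proof (rule is_graphI)
    fix e assume "e \<in> lines (flip G X Y)"
    then show "\<exists>a b. e = {a, b} \<and> a \<in> verts (flip G X Y) \<and> b \<in> verts (flip G X Y) \<and> a \<noteq> b"
      using g unfolding is_graph_def by auto
  next
    fix a b assume "a \<rightarrow>\<^bsub>flip G X Y\<^esub> b"
    then show "\<not> b \<rightarrow>\<^bsub>flip G X Y\<^esub> a \<and> \<not> a \<midarrow>\<^bsub>flip G X Y\<^esub> b"
      using is_graphD(4,5)[OF g, of a b] is_graphD(4,5)[OF g, of b a] c(3)[of a b] c(3)[of b a]
        is_graphD(2)[OF g, of a b] is_graphD(2)[OF g, of b a] line_sym[of a b G] by auto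
  qed (use is_graphD(1,2)[OF g] c(3) in auto)
  define R where "R = (\<lambda>v. \<exists>u \<in> X \<union> Y. (u, v) \<in> (steps G)\<^sup>*)"
  define level :: "'a \<Rightarrow> nat" where
    "level = (\<lambda>v. if v \<in> Y then 1 else if v \<in> X then 2 else if R v then 3 else 0)"
  have disj: "x \<notin> Y" if "x \<in> X" for x using c(3)[OF that, of x] is_graphD(2)[OF g, of x x] by blast
  have R_step: "R v" if "R u" "(u, v) \<in> steps G" for u v
    using that unfolding R_def by (meson rtrancl_into_rtrancl)
  have no_return: "v \<notin> X \<union> Y" if uv: "u \<rightarrow>\<^bsub>G\<^esub> v" and Ru: "R u" and u: "u \<notin> X \<union> Y" for u v
  proof
    assume "v \<in> X \<union> Y"
    then obtain x where x: "x \<in> X" "u \<rightarrow>\<^bsub>G\<^esub> x" using c(1,2,6) uv u by blast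
    obtain w where w: "w \<in> X \<union> Y" "(w, u) \<in> (steps G)\<^sup>*" using Ru unfolding R_def by blast
    have "(x, w) \<in> (steps G)\<^sup>*"
      using w(1) c(3)[OF x(1), of w] c(4)[OF x(1), of w] by (auto simp: steps_def)
    then show False using w(2) no_closed_walk[OF G x(2)] by (meson rtrancl_trans)
  qed
  show "adicyclic (flip G X Y)"
  proof (rule adicyclic_if_ranked[where r = "\<lambda>v. (level v, rank G v)"])
    fix a b assume "a \<rightarrow>\<^bsub>flip G X Y\<^esub> b"
    then consider "a \<in> Y" "b \<in> X" | "a \<rightarrow>\<^bsub>G\<^esub> b" "\<not> (a \<in> X \<and> b \<in> Y)" "\<not> (a \<in> Y \<and> b \<in> X)" by auto
    then show "(level a, rank G a) < (level b, rank G b)"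
    proof cases
      case 1
      then show ?thesis using disj by (auto simp: level_def)
    next
      case 2
      have "(a, b) \<in> steps G" using 2 by (simp add: steps_def)
      have lt: "rank G a < rank G b" using rank_less[OF G 2(1)] .
      show ?thesis
      proof (cases "a \<in> X \<union> Y")
        case True
        have "b \<notin> X \<union> Y"
          using True 2 c(4)[of a b] c(5)[of a b] is_graphD(2,5)[OF g 2(1)] by blast
        moreover have "R b" using True \<open>(a, b) \<in> steps G\<close> unfolding R_def by blast
        ultimately show ?thesis using True by (auto simp: level_def)
      next
        case False
        then show ?thesis using no_return[OF 2(1)] R_step[OF _ \<open>(a, b) \<in> steps G\<close>] lt
          by (auto simp: level_def)
      qed
    qed
  next
    fix a b assume "a \<midarrow>\<^bsub>flip G X Y\<^esub> b"
    then have ab: "a \<midarrow>\<^bsub>G\<^esub> b" "b \<midarrow>\<^bsub>G\<^esub> a" using line_sym[of a b G] by auto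
    then have "(a, b) \<in> steps G" "(b, a) \<in> steps G" by (auto simp: steps_def)
    then have "R a \<longleftrightarrow> R b" using R_step by blast
    moreover have "a \<in> X \<longleftrightarrow> b \<in> X" "a \<in> Y \<longleftrightarrow> b \<in> Y" using c(4,5) ab by blast+
    ultimately show "(level a, rank G a) = (level b, rank G b)"
      using rank_line[OF ab(1)] by (simp add: level_def)
  qed
qed

lemma flip_amp_equivalent:
  assumes G: "chain_graph G" and cov: "covered G X Y"
  shows "amp_equivalent (flip G X Y) G"
proof -
  have g: "is_graph G" and g': "is_graph (flip G X Y)"
    using G flip_chain_graph[OF assms] by (auto simp: chain_graph_def)
  note c = coveredD[OF cov]
  have adj: "adjacent (flip G X Y) a b \<longleftrightarrow> adjacent G a b" for a b
    using c(3)[of a b] c(3)[of b a] unfolding adjacent_def by auto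
  have clique: "adjacent G p q" if "p \<in> X \<union> Y" "q \<in> X \<union> Y" "p \<noteq> q" for p q
    using that c(3)[of p q] c(3)[of q p] c(4)[of p q] c(5)[of p q] unfolding adjacent_def by blast
  have parent: "z \<rightarrow>\<^bsub>G\<^esub> q" if "z \<rightarrow>\<^bsub>G\<^esub> p" "z \<notin> X \<union> Y" "p \<in> X \<union> Y" "q \<in> X \<union> Y" for z p q
    using that c(1,2) c(6)[of z] by blast
  (* An edge inside X \<union> Y lies in an unshielded pair of edges only together with an arrow that
     leaves X \<union> Y, before and after the flip; so flipped edges never take part in a triplex. *)
  have leaving: "\<not> triplex G a b d \<and> \<not> triplex (flip G X Y) a b d" if "a \<in> X \<union> Y" "b \<in> X \<union> Y" for a b d
  proof (cases "a \<noteq> d \<and> \<not> adjacent G a d")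
    case True
    then have d: "d \<notin> X \<union> Y" using clique that by blast
    have "\<not> b \<midarrow>\<^bsub>G\<^esub> d" using c(4,5) that(2) d by blast
    moreover have "\<not> d \<rightarrow>\<^bsub>G\<^esub> b"
    proof
      assume "d \<rightarrow>\<^bsub>G\<^esub> b"
      then have "d \<rightarrow>\<^bsub>G\<^esub> a" using parent d that by blast
      then show False using True by (simp add: adjacent_def)
    qed
    ultimately show ?thesis using d by (auto simp: triplex_def)
  next
    case False
    then show ?thesis using adj by (auto simp: triplex_def)
  qed
  have "triplex (flip G X Y) a b d \<longleftrightarrow> triplex G a b d" for a b d
  proof (cases "b \<in> X \<union> Y \<and> (a \<in> X \<union> Y \<or> d \<in> X \<union> Y)")
    case True
    then show ?thesis using leaving triplex_sym by metis
  next
    case False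
    then show ?thesis using adj by (auto simp: triplex_def)
  qed
  then show ?thesis using adj amp_equivalent_iff[OF g' g] by simp
qed

section \<open>Reversals between chain graphs with the same lines\<close>

text \<open>
  The form in which the equality of triplexes is used to compare two members: two edges that form a
  collider or a flag in one graph, while in the other there is an arrow out of the middle vertex,
  must be shielded.
\<close>

lemma unshielded_nontriplex:
  assumes "is_graph G" "is_graph H" "amp_equivalent G H" "a \<noteq> c"
    and "a \<rightarrow>\<^bsub>G\<^esub> b" "c \<rightarrow>\<^bsub>G\<^esub> b \<or> b \<midarrow>\<^bsub>G\<^esub> c" "b \<rightarrow>\<^bsub>H\<^esub> a \<or> b \<rightarrow>\<^bsub>H\<^esub> c"
  shows "adjacent G a c"
proof (rule ccontr)
  assume "\<not> adjacent G a c"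
  then have "triplex G a b c" using assms(4-6) by (auto simp: triplex_def)
  then have "triplex H a b c" using assms(1-3) amp_equivalent_iff by blast
  then show False
    using assms(7) is_graphD(4,5)[OF assms(2), of b a] is_graphD(4,5)[OF assms(2), of b c]
      line_sym[of a b H]
    unfolding triplex_def by blast
qed

definition reversed :: "'a graph \<Rightarrow> 'a graph \<Rightarrow> 'a \<Rightarrow> 'a \<Rightarrow> bool" where
  "reversed G H x y \<longleftrightarrow> x \<rightarrow>\<^bsub>G\<^esub> y \<and> y \<rightarrow>\<^bsub>H\<^esub> x"

lemma reversed_swap: "reversed G H x y \<longleftrightarrow> reversed H G y x"
  by (auto simp: reversed_def)

text \<open>
  The properties of the finest members of an equivalence class that the comparison of two of them
  rests on. All members have the same lines \<open>L\<close>, so that the line components do not depend on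
  the member.
\<close>

locale flip_closed =
  fixes \<F> :: "'a graph set" and L :: "'a set set"
  assumes chain: "G \<in> \<F> \<Longrightarrow> chain_graph G"
    and lines_eq: "G \<in> \<F> \<Longrightarrow> lines G = L"
    and equiv: "G \<in> \<F> \<Longrightarrow> H \<in> \<F> \<Longrightarrow> amp_equivalent G H"
    and flip_mem: "G \<in> \<F> \<Longrightarrow> covered G X Y \<Longrightarrow> flip G X Y \<in> \<F>"
begin

definition component :: "'a \<Rightarrow> 'a set" where
  "component x = {y. (x, y) \<in> {(u, v). {u, v} \<in> L}\<^sup>*}"

lemma graph: "G \<in> \<F> \<Longrightarrow> is_graph G"
  using chain by (simp add: chain_graph_def)

lemma comp_self [simp]: "x \<in> component x"
  by (simp add: component_def)

lemma comp_eq: "y \<in> component x \<Longrightarrow> component y = component x"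
proof -
  assume "y \<in> component x"
  moreover have "sym {(u, v). {u, v} \<in> L}" by (rule symI) (simp add: insert_commute)
  ultimately have "(x, y) \<in> {(u, v). {u, v} \<in> L}\<^sup>*" "(y, x) \<in> {(u, v). {u, v} \<in> L}\<^sup>*"
    using sym_rtrancl[of "{(u, v). {u, v} \<in> L}"] by (auto simp: component_def dest: symD)
  then show "component y = component x" unfolding component_def by (auto intro: rtrancl_trans)
qed

lemma mem_comp_iff: "y \<in> component x \<longleftrightarrow> component y = component x"
  using comp_eq comp_self by metis

lemma line_comp: "{x, y} \<in> L \<Longrightarrow> component y = component x"
  by (rule comp_eq) (auto simp: component_def)

lemma adjacent_eq: "G \<in> \<F> \<Longrightarrow> H \<in> \<F> \<Longrightarrow> adjacent G x y \<longleftrightarrow> adjacent H x y"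
  using amp_equivalent_iff[OF graph graph] equiv by blast

lemma rank_comp:
  assumes "G \<in> \<F>" "component y = component x"
  shows "rank G y = rank G x"
proof -
  have "(x, y) \<in> {(u, v). {u, v} \<in> L}\<^sup>*" using assms(2) comp_self[of y] by (simp add: component_def)
  then show ?thesis
    by induction (use rank_line[of _ _ G] lines_eq[OF assms(1)] in auto)
qed

lemma arrow_comp: "G \<in> \<F> \<Longrightarrow> x \<rightarrow>\<^bsub>G\<^esub> y \<Longrightarrow> component x \<noteq> component y"
  using rank_less[OF chain] rank_comp by (metis less_irrefl)

lemma adjacent_cases:
  assumes "G \<in> \<F>" "adjacent G x y" "component x \<noteq> component y"
  shows "x \<rightarrow>\<^bsub>G\<^esub> y \<or> y \<rightarrow>\<^bsub>G\<^esub> x"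
  using assms lines_eq line_comp unfolding adjacent_def by metis

lemma arrow_cases:
  assumes "G \<in> \<F>" "H \<in> \<F>" "x \<rightarrow>\<^bsub>G\<^esub> y"
  shows "x \<rightarrow>\<^bsub>H\<^esub> y \<or> reversed G H x y"
  using assms adjacent_cases[of H x y] adjacent_eq[of G H x y] arrow_comp[of G x y]
  by (auto simp: adjacent_def reversed_def)

lemma shielded:
  assumes "G \<in> \<F>" "H \<in> \<F>" "x \<noteq> z" "x \<rightarrow>\<^bsub>G\<^esub> y" "z \<rightarrow>\<^bsub>G\<^esub> y \<or> y \<midarrow>\<^bsub>G\<^esub> z"
    and "y \<rightarrow>\<^bsub>H\<^esub> x \<or> y \<rightarrow>\<^bsub>H\<^esub> z"
  shows "adjacent G x z"
  using unshielded_nontriplex[OF graph graph equiv] assms by metis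

text \<open>
  \<open>x \<rightarrow> y \<midarrow> y'\<close> is a flag in \<open>G\<close> unless it is shielded, and \<open>H\<close> has \<open>y \<rightarrow> x\<close>; adicyclicity then fixes the
  direction of the third edge in both graphs.
\<close>

lemma reversed_line:
  assumes "G \<in> \<F>" "H \<in> \<F>" "reversed G H x y" "{y, y'} \<in> L"
  shows "reversed G H x y'"
proof -
  have xy: "x \<rightarrow>\<^bsub>G\<^esub> y" "y \<rightarrow>\<^bsub>H\<^esub> x" using assms(3) by (auto simp: reversed_def)
  have l: "y \<midarrow>\<^bsub>G\<^esub> y'" "y' \<midarrow>\<^bsub>H\<^esub> y" using assms lines_eq by (auto simp: insert_commute)
  have "x \<noteq> y'" using l(1) arrow_comp[OF assms(1) xy(1)] line_comp[OF assms(4)] by blast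
  then have adj: "adjacent G x y'" using shielded[OF assms(1,2) _ xy(1)] l xy by blast
  then have "x \<rightarrow>\<^bsub>G\<^esub> y'" using triangle_arrow[OF chain[OF assms(1)] adj] xy l by blast
  moreover have "adjacent H y' x" using adj adjacent_eq[OF assms(1,2)] adjacent_sym[of H] by blast
  then have "y' \<rightarrow>\<^bsub>H\<^esub> x" using triangle_arrow[OF chain[OF assms(2)]] xy l by blast
  ultimately show ?thesis by (simp add: reversed_def)
qed

lemma reversed_comp:
  assumes "G \<in> \<F>" "H \<in> \<F>" "reversed G H x y" "component x' = component x" "component y' = component y"
  shows "reversed G H x' y'"
proof -
  have walk: "(x, x') \<in> {(u, v). {u, v} \<in> L}\<^sup>*" if "component x' = component x" for x x'
    using that comp_self[of x'] by (simp add: component_def)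
  have "reversed G H x y'"
    using walk[OF assms(5)]
    by induction (use assms reversed_line in auto)
  then have 1: "reversed H G y' x" by (simp add: reversed_swap)
  have "reversed H G y' x'"
    using walk[OF assms(4)]
    by induction (use assms 1 reversed_line in auto)
  then show ?thesis by (simp add: reversed_swap)
qed

text \<open>
  Two nonadjacent vertices of the component would form a collider at \<open>y\<close> in \<open>G\<close> but not in \<open>H\<close>.
\<close>

lemma reversed_clique_tail:
  assumes "G \<in> \<F>" "H \<in> \<F>" "reversed G H x y" "component u = component x" "component v = component x" "u \<noteq> v"
  shows "{u, v} \<in> L"
proof -
  have "reversed G H u y" "reversed G H v y" using assms reversed_comp by blast+
  then have "adjacent G u v" using shielded[OF assms(1,2,6)] unfolding reversed_def by blast
  then show ?thesis
    using arrow_comp[OF assms(1)] assms(1,4,5) lines_eq unfolding adjacent_def by metis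
qed

lemma reversed_clique_head:
  assumes "G \<in> \<F>" "H \<in> \<F>" "reversed G H x y" "component u = component y" "component v = component y" "u \<noteq> v"
  shows "{u, v} \<in> L"
  using reversed_clique_tail[OF assms(2,1)] assms(3-) reversed_swap by metis

lemma coveredI:
  assumes G: "G \<in> \<F>"
    and arrows: "\<And>x' y'. component x' = component x \<Longrightarrow> component y' = component y \<Longrightarrow> x' \<rightarrow>\<^bsub>G\<^esub> y'"
    and clique_x: "\<And>u v. component u = component x \<Longrightarrow> component v = component x \<Longrightarrow> u \<noteq> v \<Longrightarrow> {u, v} \<in> L"
    and clique_y: "\<And>u v. component u = component y \<Longrightarrow> component v = component y \<Longrightarrow> u \<noteq> v \<Longrightarrow> {u, v} \<in> L"
    and parents: "\<And>z x' y'. component z \<noteq> component x \<Longrightarrow> component z \<noteq> component y \<Longrightarrow> component x' = component x \<Longrightarrow>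
      component y' = component y \<Longrightarrow> z \<rightarrow>\<^bsub>G\<^esub> x' \<longleftrightarrow> z \<rightarrow>\<^bsub>G\<^esub> y'"
  shows "covered G (component x) (component y)"
proof -
  have cl: "u \<midarrow>\<^bsub>G\<^esub> z \<longleftrightarrow> z \<in> S \<and> z \<noteq> u" if "S \<in> {component x, component y}" "u \<in> S" for S u z
  proof
    assume l: "u \<midarrow>\<^bsub>G\<^esub> z"
    then have "component z = component u" using lines_eq[OF G] line_comp by simp
    then show "z \<in> S \<and> z \<noteq> u"
      using that is_graphD(3)[OF graph[OF G] l] by (auto simp: mem_comp_iff)
  next
    assume "z \<in> S \<and> z \<noteq> u"
    then have "{u, z} \<in> L" using that clique_x[of u z] clique_y[of u z] by (auto simp: mem_comp_iff)
    then show "u \<midarrow>\<^bsub>G\<^esub> z" using lines_eq[OF G] by simp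
  qed
  show ?thesis unfolding covered_def
  proof (intro conjI)
    show "component x \<noteq> {}" "component y \<noteq> {}" using comp_self by blast+
    show "\<forall>u\<in>component x. \<forall>v\<in>component y. u \<rightarrow>\<^bsub>G\<^esub> v" using arrows by (simp add: mem_comp_iff)
    show "\<forall>S\<in>{component x, component y}. \<forall>u\<in>S. \<forall>z. u \<midarrow>\<^bsub>G\<^esub> z \<longleftrightarrow> z \<in> S \<and> z \<noteq> u" using cl by blast
    show "\<forall>z. z \<notin> component x \<union> component y \<longrightarrow> (\<forall>u\<in>component x. \<forall>v\<in>component y. z \<rightarrow>\<^bsub>G\<^esub> u \<longleftrightarrow> z \<rightarrow>\<^bsub>G\<^esub> v)"
      by (intro allI impI ballI parents) (auto simp: mem_comp_iff)
  qed
qed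

text \<open>
  A parent \<open>z\<close> of \<open>x\<close>, not being reversed, forms with \<open>y \<rightarrow> x\<close> a collider in \<open>H\<close> but not in \<open>G\<close>, so
  it is adjacent to \<open>y\<close>. A parent \<open>z\<close> of \<open>y\<close> forms with \<open>x \<rightarrow> y\<close> a collider in \<open>G\<close> but not in \<open>H\<close>, so
  it is adjacent to \<open>x\<close>; if \<open>G\<close> had \<open>x \<rightarrow> z\<close>, the last two hypotheses would leave \<open>x \<rightarrow> z \<rightarrow> y\<close>
  as it is and so create a directed triangle in \<open>H\<close>.
\<close>

lemma covered_if_locally_extremal:
  assumes G: "G \<in> \<F>" and H: "H \<in> \<F>" and rev: "reversed G H x y"
    and A: "\<And>z. \<not> reversed G H z x"
    and B1: "\<And>z y'. component y' = component y \<Longrightarrow> z \<rightarrow>\<^bsub>G\<^esub> y' \<Longrightarrow> \<not> reversed G H x z"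
    and B2: "\<And>z. reversed G H z y \<Longrightarrow> rank G z \<le> rank G x"
  shows "covered G (component x) (component y)"
proof (rule coveredI[OF G])
  show "x' \<rightarrow>\<^bsub>G\<^esub> y'" if "component x' = component x" "component y' = component y" for x' y'
    using reversed_comp[OF G H rev that] by (simp add: reversed_def)
  show "{u, v} \<in> L" if "component u = component x" "component v = component x" "u \<noteq> v" for u v
    using reversed_clique_tail[OF G H rev that] .
  show "{u, v} \<in> L" if "component u = component y" "component v = component y" "u \<noteq> v" for u v
    using reversed_clique_head[OF G H rev that] .
  fix z x' y' assume z: "component z \<noteq> component x" "component z \<noteq> component y" and x': "component x' = component x" and y': "component y' = component y"
  have rev': "reversed G H x' y'" using reversed_comp[OF G H rev x' y'] .
  then have xy: "x' \<rightarrow>\<^bsub>G\<^esub> y'" "y' \<rightarrow>\<^bsub>H\<^esub> x'" by (auto simp: reversed_def)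
  show "z \<rightarrow>\<^bsub>G\<^esub> x' \<longleftrightarrow> z \<rightarrow>\<^bsub>G\<^esub> y'"
  proof
    assume zx: "z \<rightarrow>\<^bsub>G\<^esub> x'"
    have "\<not> reversed G H z x'" using A reversed_comp[OF G H] x' by metis
    then have "z \<rightarrow>\<^bsub>H\<^esub> x'" using arrow_cases[OF G H zx] by blast
    then have "adjacent H z y'" using shielded[OF H G, of z y' x'] z(2) y' xy by blast
    then have "adjacent G z y'" using adjacent_eq[OF G H] by blast
    then show "z \<rightarrow>\<^bsub>G\<^esub> y'" using triangle_arrow[OF chain[OF G]] zx xy by blast
  next
    assume zy: "z \<rightarrow>\<^bsub>G\<^esub> y'"
    then have "adjacent G z x'" using shielded[OF G H, of z x' y'] z(1) x' xy by blast
    then consider "z \<rightarrow>\<^bsub>G\<^esub> x'" | "x' \<rightarrow>\<^bsub>G\<^esub> z" using adjacent_cases[OF G] z(1) x' by metis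
    then show "z \<rightarrow>\<^bsub>G\<^esub> x'"
    proof cases
      case 2
      have "\<not> reversed G H x' z" using B1[OF y' zy] reversed_comp[OF G H] x' by metis
      then have xz: "x' \<rightarrow>\<^bsub>H\<^esub> z" using arrow_cases[OF G H 2] by blast
      have "rank G x < rank G z" using rank_less[OF chain[OF G] 2] rank_comp[OF G x'] by simp
      then have "\<not> reversed G H z y'" using B2[of z] reversed_comp[OF G H] y' by (metis leD)
      then have "z \<rightarrow>\<^bsub>H\<^esub> y'" using arrow_cases[OF G H zy] by blast
      then have "rank H x' < rank H x'"
        using rank_less[OF chain[OF H]] xz xy(2) by (meson less_trans)
      then show ?thesis by simp
    qed
  qed
qed

text \<open>
  The extremal choice is due to Chickering for acyclic directed graphs: a reversed arrow whose head
  is as early as possible and, for this head, whose tail is as late as possible is covered.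
\<close>

lemma covered_if_extremal:
  assumes G: "G \<in> \<F>" and H: "H \<in> \<F>" and "reversed G H u v"
  obtains x y where "reversed G H x y" "covered G (component x) (component y)"
    "\<And>u v. reversed G H u v \<Longrightarrow> rank G y \<le> rank G v"
proof -
  obtain y where y: "\<exists>x. reversed G H x y" and min: "\<And>u v. reversed G H u v \<Longrightarrow> rank G y \<le> rank G v"
    using ex_has_least_nat[of "\<lambda>y. \<exists>x. reversed G H x y" v "rank G"] assms(3) by blast
  have below: "reversed G H w y \<Longrightarrow> rank G w < rank G y" for w
    using rank_less[OF chain[OF G]] by (simp add: reversed_def)
  obtain x where x: "reversed G H x y" and max: "\<And>w. reversed G H w y \<Longrightarrow> rank G w \<le> rank G x"
    using ex_has_greatest_nat[of "\<lambda>x. reversed G H x y" _ "rank G" "rank G y"] y below by blast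
  have "covered G (component x) (component y)"
  proof (rule covered_if_locally_extremal[OF G H x _ _ max])
    show "\<not> reversed G H z x" for z using min below[OF x] by (meson leD)
    show "\<not> reversed G H x z" if "component y' = component y" "z \<rightarrow>\<^bsub>G\<^esub> y'" for z y'
      using min[of x z] rank_less[OF chain[OF G] that(2)] rank_comp[OF G that(1)] by auto
  qed
  then show thesis using that x min by blast
qed

text \<open>
  The distance between two members counts pairs of components rather than pairs of
  vertices: one flip then changes it by one whatever the sizes of the components.
\<close>

definition blocks :: "'a graph \<Rightarrow> 'a graph \<Rightarrow> ('a set \<times> 'a set) set" where
  "blocks G H = {(component x, component y) |x y. reversed G H x y}"

lemma mem_blocks:
  assumes "G \<in> \<F>" "H \<in> \<F>"
  shows "(component x, component y) \<in> blocks G H \<longleftrightarrow> reversed G H x y"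
proof
  assume "(component x, component y) \<in> blocks G H"
  then obtain x' y' where "component x = component x'" "component y = component y'" "reversed G H x' y'"
    unfolding blocks_def by blast
  then show "reversed G H x y" using reversed_comp[OF assms] by blast
qed (auto simp: blocks_def)

lemma finite_blocks: "G \<in> \<F> \<Longrightarrow> finite (blocks G H)"
proof -
  assume "G \<in> \<F>"
  note g = graph[OF this]
  have "blocks G H \<subseteq> (component ` verts G) \<times> (component ` verts G)"
    unfolding blocks_def reversed_def using is_graphD(2)[OF g] by blast
  then show ?thesis using is_graphD(1)[OF g] by (meson finite_SigmaI finite_imageI finite_subset)
qed

lemma card_blocks_swap: "card (blocks G H) = card (blocks H G)"
proof -
  have "blocks H G = (blocks G H)\<inverse>" unfolding blocks_def reversed_def by blast
  then show ?thesis by simp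
qed

lemma reversed_flip:
  "reversed (flip G (component x) (component y)) H u v \<longleftrightarrow>
    reversed G H u v \<and> \<not> (component u = component x \<and> component v = component y) \<or>
    component u = component y \<and> component v = component x \<and> v \<rightarrow>\<^bsub>H\<^esub> u"
  by (auto simp: reversed_def mem_comp_iff)

lemma card_blocks_flip:
  assumes G: "G \<in> \<F>" and H: "H \<in> \<F>" and cov: "covered G (component x) (component y)" and rev: "reversed G H x y"
  shows "card (blocks (flip G (component x) (component y)) H) < card (blocks G H)"
proof (rule psubset_card_mono[OF finite_blocks[OF G]])
  have "\<not> v \<rightarrow>\<^bsub>H\<^esub> u" if "component u = component y" "component v = component x" for u v
    using reversed_comp[OF G H rev that(2,1)] is_graphD(4)[OF graph[OF H], of u v] by (auto simp: reversed_def)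
  then have "blocks (flip G (component x) (component y)) H \<subseteq> blocks G H - {(component x, component y)}"
    unfolding blocks_def reversed_flip by auto
  moreover have "(component x, component y) \<in> blocks G H" using mem_blocks[OF G H] rev by simp
  ultimately show "blocks (flip G (component x) (component y)) H \<subset> blocks G H" by blast
qed

end

section \<open>Triangles with one compelled arrow\<close>

locale flip_closed_triangle = flip_closed \<F> L
  for \<F> :: "'a graph set" and L +
  fixes a b c :: 'a
  assumes compelled: "D \<in> \<F> \<Longrightarrow> a \<rightarrow>\<^bsub>D\<^esub> b"
begin

definition witness :: "'a graph \<Rightarrow> 'a graph \<Rightarrow> bool" where
  "witness G H \<longleftrightarrow> G \<in> \<F> \<and> H \<in> \<F> \<and> c \<rightarrow>\<^bsub>G\<^esub> a \<and> c \<rightarrow>\<^bsub>G\<^esub> b \<and> a \<rightarrow>\<^bsub>H\<^esub> c \<and> b \<rightarrow>\<^bsub>H\<^esub> c"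

definition minimal_witness :: "'a graph \<Rightarrow> 'a graph \<Rightarrow> bool" where
  "minimal_witness G H \<longleftrightarrow> witness G H \<and>
     (\<forall>G' H'. witness G' H' \<longrightarrow> card (blocks G H) \<le> card (blocks G' H'))"

lemma minimal_witnessD:
  assumes "minimal_witness G H"
  shows "G \<in> \<F>" "H \<in> \<F>" "c \<rightarrow>\<^bsub>G\<^esub> a" "c \<rightarrow>\<^bsub>G\<^esub> b" "a \<rightarrow>\<^bsub>H\<^esub> c" "b \<rightarrow>\<^bsub>H\<^esub> c"
    "reversed G H c a" "reversed G H c b"
    "component a \<noteq> component b" "component b \<noteq> component c" "component a \<noteq> component c"
proof -
  show 1: "G \<in> \<F>" "H \<in> \<F>" "c \<rightarrow>\<^bsub>G\<^esub> a" "c \<rightarrow>\<^bsub>G\<^esub> b" "a \<rightarrow>\<^bsub>H\<^esub> c" "b \<rightarrow>\<^bsub>H\<^esub> c"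
    using assms unfolding minimal_witness_def witness_def by auto
  then show "reversed G H c a" "reversed G H c b" by (auto simp: reversed_def)
  show "component a \<noteq> component b" "component b \<noteq> component c" "component a \<noteq> component c"
    using arrow_comp[of H] arrow_comp[OF 1(1) compelled] 1 by blast+
qed

text \<open>
  Flipping a covered reversed arrow of \<open>G\<close> decreases the distance to \<open>H\<close>, so by minimality it
  destroys \<open>c \<rightarrow> a\<close> or \<open>c \<rightarrow> b\<close>; and \<open>c \<rightarrow> b\<close> is not covered, because \<open>a\<close> is a parent of \<open>b\<close> but not of \<open>c\<close>.
\<close>

lemma covered_in_first:
  assumes mw: "minimal_witness G H" and rev: "reversed G H x y" and cov: "covered G (component x) (component y)"
  shows "component x = component c \<and> component y = component a"
proof (rule ccontr)
  note m = minimal_witnessD[OF mw]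
  assume n: "\<not> (component x = component c \<and> component y = component a)"
  have "\<not> (component x = component c \<and> component y = component b)"
  proof
    assume e: "component x = component c \<and> component y = component b"
    then have "a \<rightarrow>\<^bsub>G\<^esub> c \<longleftrightarrow> a \<rightarrow>\<^bsub>G\<^esub> b"
      using coveredD(6)[OF cov, of a c b] m(9-) by (auto simp: mem_comp_iff)
    then show False using compelled[OF m(1)] is_graphD(4)[OF graph[OF m(1)] m(3)] by blast
  qed
  then have "witness (flip G (component x) (component y)) H"
    using n m(1-6) flip_mem[OF m(1) cov] unfolding witness_def by (auto simp: mem_comp_iff)
  then show False
    using mw card_blocks_flip[OF m(1,2) cov rev] unfolding minimal_witness_def by (meson leD)
qed

text \<open>
  The counterpart in \<open>H\<close>, where \<open>a \<rightarrow> c\<close> is not covered because of \<open>a \<rightarrow> b \<rightarrow> c\<close>.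
\<close>

lemma covered_in_second:
  assumes mw: "minimal_witness G H" and rev: "reversed H G x y" and cov: "covered H (component x) (component y)"
  shows "component x = component b \<and> component y = component c"
proof (rule ccontr)
  note m = minimal_witnessD[OF mw]
  assume n: "\<not> (component x = component b \<and> component y = component c)"
  have "\<not> (component x = component a \<and> component y = component c)"
  proof
    assume e: "component x = component a \<and> component y = component c"
    then have "b \<rightarrow>\<^bsub>H\<^esub> a \<longleftrightarrow> b \<rightarrow>\<^bsub>H\<^esub> c"
      using coveredD(6)[OF cov, of b a c] m(9-) by (auto simp: mem_comp_iff)
    then show False using m(6) is_graphD(4)[OF graph[OF m(2)] compelled[OF m(2)]] by blast
  qed
  then have "witness G (flip H (component x) (component y))"
    using n m(1-6) flip_mem[OF m(2) cov] unfolding witness_def by (auto simp: mem_comp_iff)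
  then show False
    using mw card_blocks_flip[OF m(2,1) cov rev] card_blocks_swap
    unfolding minimal_witness_def by (metis leD)
qed

text \<open>
  The extremal covered arrow that always exists can only be \<open>c \<rightarrow> a\<close>; so the head \<open>a\<close> is earliest among
  all heads of reversed arrows in \<open>G\<close>. The next lemma draws the same conclusion for \<open>b \<rightarrow> c\<close> in \<open>H\<close>.
\<close>

lemma covered_ca:
  assumes "minimal_witness G H"
  shows "covered G (component c) (component a)"
    and "reversed G H u v \<Longrightarrow> rank G a \<le> rank G v"
proof -
  note m = minimal_witnessD[OF assms]
  obtain x y where xy: "reversed G H x y" "covered G (component x) (component y)"
    "\<And>u v. reversed G H u v \<Longrightarrow> rank G y \<le> rank G v"
    using covered_if_extremal[OF m(1,2,7)] by blast
  have e: "component x = component c" "component y = component a" using covered_in_first[OF assms xy(1,2)] by auto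
  then show "covered G (component c) (component a)" using xy(2) by simp
  show "rank G a \<le> rank G v" if "reversed G H u v"
    using xy(3)[OF that] rank_comp[OF m(1) e(2)] by simp
qed

lemma rank_c_least:
  assumes "minimal_witness G H" "reversed G H u v"
  shows "rank H c \<le> rank H u"
proof -
  note m = minimal_witnessD[OF assms(1)]
  have "reversed H G v u" using assms(2) by (simp add: reversed_swap)
  then obtain x y where xy: "reversed H G x y" "covered H (component x) (component y)"
    "\<And>u v. reversed H G u v \<Longrightarrow> rank H y \<le> rank H v"
    using covered_if_extremal[OF m(2,1)] by blast
  have "component y = component c" using covered_in_second[OF assms(1) xy(1,2)] by auto
  then show ?thesis using xy(3)[OF \<open>reversed H G v u\<close>] rank_comp[OF m(2)] by metis
qed

lemma parents_a:
  assumes mw: "minimal_witness G H" and "component z \<noteq> component c" "component z \<noteq> component a" "component a' = component a"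
    "component c' = component c"
  shows "z \<rightarrow>\<^bsub>G\<^esub> c' \<longleftrightarrow> z \<rightarrow>\<^bsub>G\<^esub> a'"
  using coveredD(6)[OF covered_ca(1)[OF mw], of z c' a'] assms(2-) by (simp add: mem_comp_iff)

lemma parents_c_fixed:
  assumes mw: "minimal_witness G H" and zc: "z \<rightarrow>\<^bsub>G\<^esub> c"
  shows "z \<rightarrow>\<^bsub>H\<^esub> c"
proof -
  note m = minimal_witnessD[OF mw]
  have "rank G c < rank G a" using rank_less[OF chain[OF m(1)] m(3)] .
  then have "\<not> reversed G H z c" using covered_ca(2)[OF mw] by (meson leD)
  then show ?thesis using arrow_cases[OF m(1,2) zc] by blast
qed

text \<open>
  Any parent \<open>z\<close> of \<open>a\<close> in \<open>G\<close> outside the component of \<open>c\<close> is also a parent of \<open>c\<close>, in \<open>H\<close> too, and so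
  comes before \<open>c\<close> in \<open>H\<close>. If \<open>z \<rightarrow> a\<close> were reversed, \<open>z\<close> would be the head of a reversed arrow in \<open>H\<close>,
  and \<open>c\<close> is earliest among these.
\<close>

lemma reversed_into_a:
  assumes mw: "minimal_witness G H" and rev: "reversed G H z a"
  shows "component z = component c"
proof (rule ccontr)
  note m = minimal_witnessD[OF mw]
  assume n: "component z \<noteq> component c"
  have za: "z \<rightarrow>\<^bsub>G\<^esub> a" using rev by (simp add: reversed_def)
  then have "z \<rightarrow>\<^bsub>G\<^esub> c" using parents_a[OF mw n] arrow_comp[OF m(1) za] by blast
  then have "rank H z < rank H c" using rank_less[OF chain[OF m(2)]] parents_c_fixed[OF mw] by blast
  then show False using rank_c_least[OF mw rev] by simp
qed

lemma not_reversed_from_a: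
  assumes mw: "minimal_witness G H"
  shows "\<not> reversed G H a y"
  using rank_c_least[OF mw] rank_less[OF chain minimal_witnessD(5)[OF mw]] minimal_witnessD(2)[OF mw]
  by (meson leD)

text \<open>
  Leave the reversed arrows into \<open>a\<close> aside and choose \<open>y\<close> earliest among the heads of the remaining
  ones, of which \<open>c \<rightarrow> b\<close> is one, and the tail \<open>x\<close> as late as possible. By \<open>covered_in_first\<close> the
  arrow \<open>x \<rightarrow> y\<close> is not covered, and the only obstruction that is left in \<open>covered_if_locally_extremal\<close>
  is a reversed arrow from \<open>x\<close> to a parent of \<open>y\<close> in the component of \<open>a\<close>. So \<open>x\<close> is in the component of \<open>c\<close>, and \<open>y\<close>
  stands to \<open>a\<close> and \<open>c\<close> as \<open>b\<close> does, except that \<open>a \<rightarrow> y\<close> need not be compelled.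
\<close>

lemma next_reversed_head:
  assumes mw: "minimal_witness G H"
  obtains y where "reversed G H c y" "a \<rightarrow>\<^bsub>G\<^esub> y"
    "\<And>u v. reversed G H u v \<Longrightarrow> component v \<noteq> component a \<Longrightarrow> rank G y \<le> rank G v"
    "\<And>u. reversed G H u y \<Longrightarrow> rank G u \<le> rank G c"
proof -
  note m = minimal_witnessD[OF mw]
  define P where "P = (\<lambda>y. (\<exists>x. reversed G H x y) \<and> component y \<noteq> component a)"
  have "P b" using m unfolding P_def by metis
  then obtain y where "P y" and min: "\<And>v. P v \<Longrightarrow> rank G y \<le> rank G v"
    using ex_has_least_nat[of P b "rank G"] by blast
  then have y: "\<exists>x. reversed G H x y" "component y \<noteq> component a" by (auto simp: P_def)
  have below: "reversed G H w y \<Longrightarrow> rank G w < rank G y" for w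
    using rank_less[OF chain[OF m(1)]] by (simp add: reversed_def)
  obtain x where x: "reversed G H x y" and max: "\<And>w. reversed G H w y \<Longrightarrow> rank G w \<le> rank G x"
    using ex_has_greatest_nat[of "\<lambda>x. reversed G H x y" _ "rank G" "rank G y"] y below by blast
  have "\<not> covered G (component x) (component y)" using covered_in_first[OF mw x] y(2) by blast
  moreover have "\<not> reversed G H z x" for z
  proof
    assume z: "reversed G H z x"
    have "component x = component a" using min[of x] z below[OF x] unfolding P_def by fastforce
    then show False using not_reversed_from_a[OF mw] reversed_comp[OF m(1,2) x] by metis
  qed
  ultimately obtain z y' where z: "component y' = component y" "z \<rightarrow>\<^bsub>G\<^esub> y'" "reversed G H x z"
    using covered_if_locally_extremal[OF m(1,2) x _ _ max] by blast
  have "rank G z < rank G y" using rank_less[OF chain[OF m(1)] z(2)] rank_comp[OF m(1) z(1)] by simp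
  then have za: "component z = component a" using min[of z] z(3) unfolding P_def by fastforce
  then have "reversed G H x a" using reversed_comp[OF m(1,2) z(3)] by simp
  then have xc: "component x = component c" using reversed_into_a[OF mw] by blast
  have cy: "reversed G H c y'" using reversed_comp[OF m(1,2) x] xc z(1) by simp
  have "adjacent H a y'"
    using shielded[OF m(2,1), of a y' c] m(3,5) cy y(2) z(1) unfolding reversed_def by metis
  then have adj: "adjacent G a y'" using adjacent_eq[OF m(1,2)] by blast
  have "a \<rightarrow>\<^bsub>G\<^esub> y'"
  proof (rule ccontr)
    assume "\<not> a \<rightarrow>\<^bsub>G\<^esub> y'"
    then have "y' \<rightarrow>\<^bsub>G\<^esub> a" using adjacent_cases[OF m(1) adj] y(2) z(1) by simp
    then have "rank G y' < rank G a" using rank_less[OF chain[OF m(1)]] by blast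
    then show False using rank_less[OF chain[OF m(1)] z(2)] rank_comp[OF m(1) za] by simp
  qed
  moreover have "rank G y' \<le> rank G v" if "reversed G H u v" "component v \<noteq> component a" for u v
    using min[of v] that rank_comp[OF m(1) z(1)] unfolding P_def by auto
  moreover have "rank G u \<le> rank G c" if "reversed G H u y'" for u
    using max[of u] reversed_comp[OF m(1,2) that] z(1) rank_comp[OF m(1) xc] by simp
  ultimately show thesis using that cy by blast
qed

text \<open>
  The delicate part is a parent \<open>z\<close> of \<open>y\<close> that is not a parent of \<open>a\<close>. Shared triplexes make it adjacent to
  \<open>c\<close> and to \<open>a\<close>, so \<open>G\<close> has \<open>c \<rightarrow> z\<close> and \<open>a \<rightarrow> z \<rightarrow> y\<close>. If \<open>c \<rightarrow> z\<close> were reversed, its head would be earlier than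
  \<open>y\<close>; if not, \<open>y \<rightarrow> c \<rightarrow> z\<close> in \<open>H\<close> makes \<open>z \<rightarrow> y\<close> reversed, with a later tail than \<open>c\<close>.
\<close>

lemma covered_a_next:
  assumes mw: "minimal_witness G H"
    and rev: "reversed G H c y" and ay: "a \<rightarrow>\<^bsub>G\<^esub> y"
    and min: "\<And>u v. reversed G H u v \<Longrightarrow> component v \<noteq> component a \<Longrightarrow> rank G y \<le> rank G v"
    and max: "\<And>u. reversed G H u y \<Longrightarrow> rank G u \<le> rank G c"
  shows "covered G (component a) (component y)"
proof (rule coveredI[OF minimal_witnessD(1)[OF mw]])
  note m = minimal_witnessD[OF mw]
  have n: "component a \<noteq> component y" using arrow_comp[OF m(1) ay] .
  show arr: "a' \<rightarrow>\<^bsub>G\<^esub> y'" if e: "component a' = component a" "component y' = component y" for a' y'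
  proof -
    have ca: "reversed G H c a'" using reversed_comp[OF m(1,2,7)] e by simp
    have cy: "reversed G H c y'" using reversed_comp[OF m(1,2) rev] e by simp
    have "adjacent H a' y'"
      using shielded[OF m(2,1), of a' y' c] ca cy n e unfolding reversed_def by metis
    then have adj: "adjacent G a' y'" using adjacent_eq[OF m(1,2)] by blast
    have "rank G a' < rank G y'" using rank_less[OF chain[OF m(1)] ay] rank_comp[OF m(1)] e by metis
    then show ?thesis using adjacent_cases[OF m(1) adj] n e rank_less[OF chain[OF m(1)], of y' a'] by auto
  qed
  show "{u, v} \<in> L" if "component u = component a" "component v = component a" "u \<noteq> v" for u v
    using reversed_clique_head[OF m(1,2,7) that] .
  show "{u, v} \<in> L" if "component u = component y" "component v = component y" "u \<noteq> v" for u v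
    using reversed_clique_head[OF m(1,2) rev that] .
  fix z a' y' assume z: "component z \<noteq> component a" "component z \<noteq> component y" and a': "component a' = component a" and y': "component y' = component y"
  have ca: "reversed G H c' a'" if "component c' = component c" for c' using reversed_comp[OF m(1,2,7)] a' that by simp
  have cy: "reversed G H c' y'" if "component c' = component c" for c' using reversed_comp[OF m(1,2) rev] y' that by simp
  have ay': "a' \<rightarrow>\<^bsub>G\<^esub> y'" using arr a' y' by blast
  show "z \<rightarrow>\<^bsub>G\<^esub> a' \<longleftrightarrow> z \<rightarrow>\<^bsub>G\<^esub> y'"
  proof (cases "component z = component c")
    case True
    then show ?thesis using ca[OF True] cy[OF True] by (simp add: reversed_def)
  next
    case False
    have par: "z \<rightarrow>\<^bsub>G\<^esub> c \<longleftrightarrow> z \<rightarrow>\<^bsub>G\<^esub> a'" using parents_a[OF mw False z(1) a'] by simp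
    have c: "c \<rightarrow>\<^bsub>G\<^esub> a'" "a' \<rightarrow>\<^bsub>H\<^esub> c" "c \<rightarrow>\<^bsub>G\<^esub> y'" "y' \<rightarrow>\<^bsub>H\<^esub> c"
      using ca[of c] cy[of c] by (auto simp: reversed_def)
    show ?thesis
    proof
      assume "z \<rightarrow>\<^bsub>G\<^esub> a'"
      then have zc: "z \<rightarrow>\<^bsub>G\<^esub> c" using par by simp
      then have "z \<rightarrow>\<^bsub>H\<^esub> c" using parents_c_fixed[OF mw] by blast
      then have "adjacent H z y'" using shielded[OF m(2,1), of z y' c] c z(2) y' by blast
      then have "adjacent G z y'" using adjacent_eq[OF m(1,2)] by blast
      then show "z \<rightarrow>\<^bsub>G\<^esub> y'" using triangle_arrow[OF chain[OF m(1)]] zc c by blast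
    next
      assume zy: "z \<rightarrow>\<^bsub>G\<^esub> y'"
      show "z \<rightarrow>\<^bsub>G\<^esub> a'"
      proof (rule ccontr)
        assume na: "\<not> z \<rightarrow>\<^bsub>G\<^esub> a'"
        have "adjacent G z c" using shielded[OF m(1,2), of z c y'] zy c False by blast
        then have cz: "c \<rightarrow>\<^bsub>G\<^esub> z" using adjacent_cases[OF m(1)] False par na by blast
        have ayH: "a' \<rightarrow>\<^bsub>H\<^esub> y'"
          using arrow_cases[OF m(1,2) ay'] not_reversed_from_a[OF mw] reversed_comp[OF m(1,2)] a' by metis
        have adj: "adjacent G z a'"
        proof (rule ccontr)
          assume nadj: "\<not> adjacent G z a'"
          then have "\<not> y' \<rightarrow>\<^bsub>H\<^esub> z" using shielded[OF m(1,2), of z a' y'] zy ay' z(1) a' by blast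
          then have zyH: "z \<rightarrow>\<^bsub>H\<^esub> y'" using arrow_cases[OF m(1,2) zy] by (auto simp: reversed_def)
          have "adjacent H z c" using \<open>adjacent G z c\<close> adjacent_eq[OF m(1,2)] by blast
          then have "z \<rightarrow>\<^bsub>H\<^esub> c" using triangle_arrow[OF chain[OF m(2)]] zyH c by blast
          then have "adjacent H z a'" using shielded[OF m(2,1), of z a' c] c z(1) a' by blast
          then show False using nadj adjacent_eq[OF m(1,2)] by blast
        qed
        then have az: "a' \<rightarrow>\<^bsub>G\<^esub> z" using adjacent_cases[OF m(1) adj] z(1) a' na by simp
        have "rank G z < rank G y" using rank_less[OF chain[OF m(1)] zy] rank_comp[OF m(1) y'] by simp
        then have "\<not> reversed G H c z" using min[OF _ z(1)] by (meson leD)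
        then have "c \<rightarrow>\<^bsub>H\<^esub> z" using arrow_cases[OF m(1,2) cz] by blast
        moreover have "adjacent H y' z"
          using zy adjacent_eq[OF m(1,2), of z y'] adjacent_sym[of H] by (simp add: adjacent_def)
        ultimately have "y' \<rightarrow>\<^bsub>H\<^esub> z" using triangle_arrow[OF chain[OF m(2)]] c by blast
        then have "reversed G H z y" using reversed_comp[OF m(1,2)] zy y' by (metis reversed_def)
        then show False using max rank_less[OF chain[OF m(1)] cz] by (meson leD)
      qed
    qed
  qed
qed

text \<open>
  With \<open>y\<close> as above, \<open>y\<close> and \<open>b\<close> are in different components, as otherwise flipping \<open>a \<rightarrow> y\<close> would reverse the
  compelled arrow \<open>a \<rightarrow> b\<close>. The first flip increases the distance to \<open>H\<close> by the pair \<open>y\<close>, \<open>a\<close>; it makes \<open>c \<rightarrow> y\<close>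
  covered, and the second flip removes the pair \<open>c\<close>, \<open>y\<close> again.
\<close>

lemma no_witness: "\<not> witness G H"
proof
  assume "witness G H"
  then obtain p where "witness (fst p) (snd p)"
    and "\<And>q. witness (fst q) (snd q) \<Longrightarrow> card (blocks (fst p) (snd p)) \<le> card (blocks (fst q) (snd q))"
    using ex_has_least_nat[of "\<lambda>p. witness (fst p) (snd p)" "(G, H)" "\<lambda>p. card (blocks (fst p) (snd p))"]
    by auto
  then obtain G H where mw: "minimal_witness G H" unfolding minimal_witness_def by (metis fst_conv snd_conv)
  note m = minimal_witnessD[OF mw]
  obtain y where y: "reversed G H c y" "a \<rightarrow>\<^bsub>G\<^esub> y"
    "\<And>u v. reversed G H u v \<Longrightarrow> component v \<noteq> component a \<Longrightarrow> rank G y \<le> rank G v"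
    "\<And>u. reversed G H u y \<Longrightarrow> rank G u \<le> rank G c"
    using next_reversed_head[OF mw] by blast
  have cov: "covered G (component a) (component y)" using covered_a_next[OF mw y] .
  define G1 where "G1 = flip G (component a) (component y)"
  have G1: "G1 \<in> \<F>" unfolding G1_def using flip_mem[OF m(1) cov] .
  have yb: "component y \<noteq> component b"
  proof
    assume "component y = component b"
    then have "b \<rightarrow>\<^bsub>G1\<^esub> a" by (simp add: G1_def mem_comp_iff)
    then show False using is_graphD(4)[OF graph[OF G1]] compelled[OF G1] by blast
  qed
  have ya: "component y \<noteq> component a" and yc: "component y \<noteq> component c"
    using arrow_comp[OF m(1)] y(1,2) unfolding reversed_def by metis+
  have cov1: "covered G1 (component c) (component y)"
  proof (rule coveredI[OF G1])
    show "c' \<rightarrow>\<^bsub>G1\<^esub> y'" if "component c' = component c" "component y' = component y" for c' y'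
      using reversed_comp[OF m(1,2) y(1) that] that m(11) by (simp add: G1_def mem_comp_iff reversed_def)
    show "{u, v} \<in> L" if "component u = component c" "component v = component c" "u \<noteq> v" for u v
      using reversed_clique_tail[OF m(1,2) y(1) that] .
    show "{u, v} \<in> L" if "component u = component y" "component v = component y" "u \<noteq> v" for u v
      using reversed_clique_head[OF m(1,2) y(1) that] .
    fix z c' y' assume z: "component z \<noteq> component c" "component z \<noteq> component y" and c': "component c' = component c" and y': "component y' = component y"
    show "z \<rightarrow>\<^bsub>G1\<^esub> c' \<longleftrightarrow> z \<rightarrow>\<^bsub>G1\<^esub> y'"
    proof (cases "component z = component a")
      case True
      have "reversed G H c' z" using reversed_comp[OF m(1,2,7) c' True] .
      then have "\<not> z \<rightarrow>\<^bsub>G\<^esub> c'" using is_graphD(4)[OF graph[OF m(1)]] unfolding reversed_def by blast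
      then show ?thesis using True z(2) y' by (simp add: G1_def mem_comp_iff)
    next
      case False
      have "z \<rightarrow>\<^bsub>G\<^esub> c' \<longleftrightarrow> z \<rightarrow>\<^bsub>G\<^esub> a" using parents_a[OF mw z(1) False _ c'] by simp
      also have "\<dots> \<longleftrightarrow> z \<rightarrow>\<^bsub>G\<^esub> y'" using coveredD(6)[OF cov, of z a y'] False z(2) y' by (simp add: mem_comp_iff)
      finally show ?thesis using False z(2) by (simp add: G1_def mem_comp_iff)
    qed
  qed
  define G2 where "G2 = flip G1 (component c) (component y)"
  have G2: "G2 \<in> \<F>" unfolding G2_def using flip_mem[OF G1 cov1] .
  have wit: "witness G2 H"
    using m(1-6) G2 yb ya m(9-11) unfolding witness_def by (auto simp: G2_def G1_def mem_comp_iff)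
  have "blocks G2 H \<subseteq> insert (component y, component a) (blocks G H - {(component c, component y)})"
  proof
    fix e assume "e \<in> blocks G2 H"
    then obtain u v where e: "e = (component u, component v)" and r: "reversed G2 H u v" unfolding blocks_def by blast
    have "\<not> v \<rightarrow>\<^bsub>H\<^esub> u" if "component u = component y" "component v = component c"
      using reversed_comp[OF m(1,2) y(1) that(2,1)] is_graphD(4)[OF graph[OF m(2)], of u v] by (auto simp: reversed_def)
    then show "e \<in> insert (component y, component a) (blocks G H - {(component c, component y)})"
      using r mem_blocks[OF m(1,2), of u v] unfolding e G2_def reversed_flip G1_def by auto
  qed
  then have "card (blocks G2 H) \<le> card (insert (component y, component a) (blocks G H - {(component c, component y)}))"
    using finite_blocks[OF m(1)] by (intro card_mono) auto
  also have "\<dots> \<le> card (blocks G H)"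
    using finite_blocks[OF m(1)] mem_blocks[OF m(1,2), of c y] y(1)
    by (metis card_Suc_Diff1 card_insert_le_m1 diff_Suc_1 le_refl zero_less_Suc finite_Diff card_insert_if Suc_leD le_SucI)
  finally have "minimal_witness G2 H"
    using mw wit unfolding minimal_witness_def by (meson order_trans)
  moreover have "reversed G2 H y a"
  proof -
    have "a \<rightarrow>\<^bsub>H\<^esub> y"
      using arrow_cases[OF m(1,2) y(2)] not_reversed_from_a[OF mw] by blast
    then show ?thesis using m(11) yc ya by (auto simp: reversed_def G2_def G1_def mem_comp_iff)
  qed
  ultimately show False using reversed_into_a yc by blast
qed

end

section \<open>The finest members of an equivalence class\<close>

lemma amp_class_chain_graph: "G \<in> amp_class G0 \<Longrightarrow> chain_graph G"
  by (simp add: amp_class_def)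

lemma amp_class_rank_less: "G \<in> amp_class G0 \<Longrightarrow> a \<rightarrow>\<^bsub>G\<^esub> b \<Longrightarrow> rank G a < rank G b"
  using amp_class_chain_graph by (rule rank_less)

lemma amp_class_is_graph: "G \<in> amp_class G0 \<Longrightarrow> is_graph G"
  by (simp add: amp_class_def chain_graph_def)

lemma amp_class_equivalent: "G \<in> amp_class G0 \<Longrightarrow> H \<in> amp_class G0 \<Longrightarrow> amp_equivalent G H"
  by (simp add: amp_class_def amp_equivalent_def)

lemma amp_class_eq:
  assumes "G \<in> amp_class G0" "H \<in> amp_class G0"
  shows "verts G = verts H" "adjacent G a b \<longleftrightarrow> adjacent H a b" "triplex G a b c \<longleftrightarrow> triplex H a b c"
  using amp_equivalent_iff[OF amp_class_is_graph amp_class_is_graph] amp_class_equivalent assms by blast+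

lemma amp_classI: "G \<in> amp_class G0 \<Longrightarrow> chain_graph K \<Longrightarrow> amp_equivalent K G \<Longrightarrow> K \<in> amp_class G0"
  by (simp add: amp_class_def amp_equivalent_def)

definition common_lines :: "'a graph \<Rightarrow> 'a set set" where
  "common_lines G0 = (\<Inter>G\<in>amp_class G0. lines G)"

definition finest :: "'a graph \<Rightarrow> 'a graph set" where
  "finest G0 = {G \<in> amp_class G0. lines G = common_lines G0}"

lemma refine_mem:
  assumes "G \<in> amp_class G0" "H \<in> amp_class G0"
  shows "refine G H \<in> amp_class G0"
proof (rule amp_classI[OF assms(1)])
  show "chain_graph (refine G H)"
    using assms by (intro refine_chain_graph amp_class_chain_graph)
  show "amp_equivalent (refine G H) G"
    using amp_class_chain_graph[OF assms(1)] amp_class_chain_graph[OF assms(2)]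
      amp_class_equivalent[OF assms] by (rule refine_amp_equivalent)
qed

text \<open>
  Refining a member with the fewest lines by any other member cannot lose lines; so its lines are
  common to all members, and refining an arbitrary member by it leaves only the common lines.
\<close>

lemma ex_finest:
  assumes "G \<in> amp_class G0"
  shows "\<exists>D\<in>finest G0. arrows G \<subseteq> arrows D"
proof -
  obtain M where M: "M \<in> amp_class G0"
    and min: "\<And>K. K \<in> amp_class G0 \<Longrightarrow> card (lines M) \<le> card (lines K)"
    using ex_has_least_nat[of "\<lambda>K. K \<in> amp_class G0" G "\<lambda>K. card (lines K)"] assms by blast
  have fin: "finite (lines M)"
  proof (rule finite_subset)
    show "lines M \<subseteq> Pow (verts M)" "finite (Pow (verts M))"
      using amp_class_is_graph[OF M] unfolding is_graph_def by auto
  qed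
  have "lines M \<subseteq> lines K" if K: "K \<in> amp_class G0" for K
  proof -
    have "card (lines M) \<le> card (lines M \<inter> lines K)"
      using min[OF refine_mem[OF M K]] by (simp add: refine_def)
    then have "lines M \<inter> lines K = lines M" using fin by (intro card_seteq) auto
    then show ?thesis by blast
  qed
  then have "lines M = common_lines G0" using M unfolding common_lines_def by blast
  moreover have "common_lines G0 \<subseteq> lines G" using assms unfolding common_lines_def by blast
  ultimately have "refine G M \<in> finest G0"
    using refine_mem[OF assms M] unfolding finest_def by (auto simp: refine_def)
  moreover have "arrows G \<subseteq> arrows (refine G M)" by (auto simp: refine_def)
  ultimately show ?thesis by blast
qed

lemma finest_flip_closed: "flip_closed (finest G0) (common_lines G0)"
proof
  fix G X Y assume "G \<in> finest G0" and cov: "covered G X Y"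
  then have G: "G \<in> amp_class G0" "lines G = common_lines G0" by (auto simp: finest_def)
  have "chain_graph G" using amp_class_chain_graph[OF G(1)] .
  then have "flip G X Y \<in> amp_class G0"
    using amp_classI[OF G(1)] flip_chain_graph[OF _ cov] flip_amp_equivalent[OF _ cov] by simp
  then show "flip G X Y \<in> finest G0" using G by (simp add: finest_def)
next
  fix G H assume "G \<in> finest G0" "H \<in> finest G0"
  then show "amp_equivalent G H" using amp_class_equivalent unfolding finest_def by blast
next
  fix G assume "G \<in> finest G0"
  then show "chain_graph G" "lines G = common_lines G0"
    using amp_class_chain_graph unfolding finest_def by blast+
qed

section \<open>The essential graph\<close>

context
  fixes G0 :: "'a graph"
  assumes G0: "chain_graph G0"
begin

lemma G0_mem: "G0 \<in> amp_class G0"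
  using G0 by (simp add: amp_class_def amp_equivalent_def)

lemma essential_arrow:
  "a \<rightarrow>\<^bsub>essential_graph G0\<^esub> b \<longleftrightarrow>
     (\<exists>G\<in>amp_class G0. a \<rightarrow>\<^bsub>G\<^esub> b) \<and> \<not> (\<exists>G\<in>amp_class G0. b \<rightarrow>\<^bsub>G\<^esub> a)"
  by (simp add: essential_graph_def)

lemma essential_line:
  "a \<midarrow>\<^bsub>essential_graph G0\<^esub> b \<longleftrightarrow> (\<forall>G\<in>amp_class G0. a \<midarrow>\<^bsub>G\<^esub> b) \<or>
     (\<exists>G\<in>amp_class G0. \<exists>H\<in>amp_class G0. a \<rightarrow>\<^bsub>G\<^esub> b \<and> b \<rightarrow>\<^bsub>H\<^esub> a)"
  by (auto simp: essential_graph_def doubleton_eq_iff insert_commute)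

lemma essential_is_graph: "is_graph (essential_graph G0)"
proof (rule is_graphI)
  have v: "verts (essential_graph G0) = verts G0" by (simp add: essential_graph_def)
  show "finite (verts (essential_graph G0))"
    using is_graphD(1)[OF amp_class_is_graph[OF G0_mem]] v by simp
  have arrow: "a \<in> verts G0 \<and> b \<in> verts G0 \<and> a \<noteq> b" if "G \<in> amp_class G0" "a \<rightarrow>\<^bsub>G\<^esub> b" for G a b
    using is_graphD(2)[OF amp_class_is_graph[OF that(1)] that(2)] amp_class_eq(1)[OF that(1) G0_mem] by simp
  show "a \<in> verts (essential_graph G0) \<and> b \<in> verts (essential_graph G0) \<and> a \<noteq> b"
    if "a \<rightarrow>\<^bsub>essential_graph G0\<^esub> b" for a b
    using that arrow unfolding essential_arrow v by blast
  show "\<exists>a b. e = {a, b} \<and> a \<in> verts (essential_graph G0) \<and> b \<in> verts (essential_graph G0) \<and> a \<noteq> b"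
    if e: "e \<in> lines (essential_graph G0)" for e
  proof -
    obtain a b where ab: "e = {a, b}" using e by (auto simp: essential_graph_def)
    then have "a \<midarrow>\<^bsub>G0\<^esub> b \<or> (\<exists>G\<in>amp_class G0. a \<rightarrow>\<^bsub>G\<^esub> b)"
      using e G0_mem unfolding ab essential_line by blast
    then have "a \<in> verts G0 \<and> b \<in> verts G0 \<and> a \<noteq> b"
      using arrow is_graphD(3)[OF amp_class_is_graph[OF G0_mem]] by blast
    then show ?thesis using ab v by blast
  qed
  show "\<not> b \<rightarrow>\<^bsub>essential_graph G0\<^esub> a \<and> \<not> a \<midarrow>\<^bsub>essential_graph G0\<^esub> b"
    if ab: "a \<rightarrow>\<^bsub>essential_graph G0\<^esub> b" for a b
  proof -
    obtain G where G: "G \<in> amp_class G0" "a \<rightarrow>\<^bsub>G\<^esub> b" using ab essential_arrow by blast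
    have "\<not> a \<midarrow>\<^bsub>G\<^esub> b" using is_graphD(5)[OF amp_class_is_graph[OF G(1)] G(2)] .
    then show ?thesis using ab G unfolding essential_arrow essential_line by blast
  qed
qed

lemma essential_adjacent:
  assumes "G \<in> amp_class G0"
  shows "adjacent (essential_graph G0) a b \<longleftrightarrow> adjacent G a b"
  using skeleton_essential_graph[OF G0] amp_class_eq(2)[OF assms G0_mem] by (simp add: adj_skel)

lemma essential_line_reversible:
  assumes "a \<midarrow>\<^bsub>essential_graph G0\<^esub> b" "G \<in> amp_class G0" "a \<rightarrow>\<^bsub>G\<^esub> b"
  obtains H where "H \<in> amp_class G0" "b \<rightarrow>\<^bsub>H\<^esub> a"
  using assms is_graphD(5)[OF amp_class_is_graph[OF assms(2)] assms(3)] unfolding essential_line by blast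

text \<open>
  If the essential graph has a triplex with \<open>a \<rightarrow> b\<close>, take a member with this arrow. Either it has the triplex, or
  it has \<open>b \<rightarrow> c\<close>; then the line \<open>b \<midarrow> c\<close> is reversible, and a member with \<open>c \<rightarrow> b\<close> has the triplex.
\<close>

lemma essential_triplex: "triplex (essential_graph G0) a b c \<longleftrightarrow> triplex G0 a b c"
proof -
  have half: "triplex G0 a b c"
    if na: "a \<noteq> c" "\<not> adjacent (essential_graph G0) a c" and ab: "a \<rightarrow>\<^bsub>essential_graph G0\<^esub> b"
      and bc: "c \<rightarrow>\<^bsub>essential_graph G0\<^esub> b \<or> b \<midarrow>\<^bsub>essential_graph G0\<^esub> c" for a b c
  proof -
    obtain G where G: "G \<in> amp_class G0" "a \<rightarrow>\<^bsub>G\<^esub> b" using ab essential_arrow by blast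
    show ?thesis
    proof (cases "b \<rightarrow>\<^bsub>G\<^esub> c")
      case False
      have "adjacent G b c" using bc essential_adjacent[OF G(1), of b c] by (auto simp: adjacent_def)
      then have "triplex G a b c"
        using G na essential_adjacent[OF G(1), of a c] False by (auto simp: triplex_def adjacent_def[of _ b c])
      then show ?thesis using amp_class_eq(3)[OF G(1) G0_mem] by blast
    next
      case True
      then have "b \<midarrow>\<^bsub>essential_graph G0\<^esub> c" using bc G(1) essential_arrow by blast
      then obtain H where H: "H \<in> amp_class G0" "c \<rightarrow>\<^bsub>H\<^esub> b"
        using essential_line_reversible G(1) True by blast
      have "\<not> b \<rightarrow>\<^bsub>H\<^esub> a" using ab H(1) essential_arrow by blast
      moreover have "adjacent H a b" using ab essential_adjacent[OF H(1), of a b] by (auto simp: adjacent_def)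
      ultimately have "triplex H a b c"
        using H na essential_adjacent[OF H(1), of a c] by (auto simp: triplex_def adjacent_def[of _ a b])
      then show ?thesis using amp_class_eq(3)[OF H(1) G0_mem] by blast
    qed
  qed
  have half': "triplex (essential_graph G0) a b c" if t: "triplex G0 a b c" and ab: "a \<rightarrow>\<^bsub>G0\<^esub> b" for a b c
  proof -
    have "\<not> b \<rightarrow>\<^bsub>G\<^esub> a \<and> \<not> b \<rightarrow>\<^bsub>G\<^esub> c" if G: "G \<in> amp_class G0" for G
    proof -
      have "triplex G a b c" using t amp_class_eq(3)[OF G G0_mem] by blast
      then show ?thesis
        using is_graphD(4,5)[OF amp_class_is_graph[OF G], of b a]
          is_graphD(4,5)[OF amp_class_is_graph[OF G], of b c] line_sym[of a b G]
        unfolding triplex_def by blast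
    qed
    then have "a \<rightarrow>\<^bsub>essential_graph G0\<^esub> b" "\<not> b \<rightarrow>\<^bsub>essential_graph G0\<^esub> c"
      using ab G0_mem essential_arrow by blast+
    moreover have "adjacent (essential_graph G0) b c"
      using t ab essential_adjacent[OF G0_mem, of b c] line_sym[of a b G0]
        is_graphD(5)[OF amp_class_is_graph[OF G0_mem] ab]
      unfolding triplex_def by (auto simp: adjacent_def)
    ultimately show ?thesis
      using t essential_adjacent[OF G0_mem, of a c] by (auto simp: triplex_def adjacent_def[of _ b c])
  qed
  show ?thesis
  proof
    assume t: "triplex (essential_graph G0) a b c"
    then consider "a \<rightarrow>\<^bsub>essential_graph G0\<^esub> b" | "c \<rightarrow>\<^bsub>essential_graph G0\<^esub> b"
      by (auto simp: triplex_def)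
    then show "triplex G0 a b c"
    proof cases
      case 1
      then show ?thesis using half[of a c b] t is_graphD(5)[OF essential_is_graph 1] by (auto simp: triplex_def)
    next
      case 2
      have t': "triplex (essential_graph G0) c b a" using t by (simp add: triplex_sym)
      then have "triplex G0 c b a"
        using half[of c a b] 2 is_graphD(5)[OF essential_is_graph 2] by (auto simp: triplex_def)
      then show ?thesis by (simp add: triplex_sym)
    qed
  next
    assume t: "triplex G0 a b c"
    then consider "a \<rightarrow>\<^bsub>G0\<^esub> b" | "c \<rightarrow>\<^bsub>G0\<^esub> b" by (auto simp: triplex_def)
    then show "triplex (essential_graph G0) a b c"
      using half'[OF t] half'[of c b a] t triplex_sym[of _ a b c] by cases auto
  qed
qed

lemma rank_essential_arrow:
  assumes "a \<rightarrow>\<^bsub>essential_graph G0\<^esub> b" "G \<in> amp_class G0"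
  shows "rank G a \<le> rank G b"
proof -
  have "adjacent G a b" "\<not> b \<rightarrow>\<^bsub>G\<^esub> a"
    using assms essential_adjacent[OF assms(2), of a b] essential_arrow by (auto simp: adjacent_def)
  then show ?thesis
    using rank_less[OF amp_class_chain_graph[OF assms(2)], of a b] rank_line[of a b G]
    by (auto simp: adjacent_def)
qed

lemma arrow_if_rank_less:
  assumes "G \<in> amp_class G0" "adjacent (essential_graph G0) a b" "rank G a < rank G b"
  shows "a \<rightarrow>\<^bsub>G\<^esub> b"
  using assms(3) rank_less[OF amp_class_chain_graph[OF assms(1)], of b a] rank_line[of a b G]
    essential_adjacent[OF assms(1), of a b] assms(2) by (auto simp: adjacent_def)

text \<open>
  A member with \<open>a \<rightarrow> b\<close> directs one of the two lines; following that line and the other one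
  through members that reverse them shows that both are directed both ways. In finest members \<open>a \<rightarrow> b\<close>
  is always present, being neither a common line nor ever reversed.
\<close>

lemma essential_triangle_lines:
  assumes ab: "a \<rightarrow>\<^bsub>essential_graph G0\<^esub> b" and bc: "b \<midarrow>\<^bsub>essential_graph G0\<^esub> c"
    and ca: "c \<midarrow>\<^bsub>essential_graph G0\<^esub> a"
  shows False
proof -
  have adj: "adjacent (essential_graph G0) c b" "adjacent (essential_graph G0) a c"
      "adjacent (essential_graph G0) c a" "adjacent (essential_graph G0) a b"
    using bc ca ab by (auto simp: adjacent_def insert_commute)
  have ac: "a \<midarrow>\<^bsub>essential_graph G0\<^esub> c" and cb: "c \<midarrow>\<^bsub>essential_graph G0\<^esub> b"
    using bc ca by (auto simp: insert_commute)
  obtain K where K: "K \<in> amp_class G0" "a \<rightarrow>\<^bsub>K\<^esub> b" using ab essential_arrow by blast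
  note less = amp_class_rank_less
  have "c \<rightarrow>\<^bsub>K\<^esub> b \<or> a \<rightarrow>\<^bsub>K\<^esub> c"
    using less[OF K] arrow_if_rank_less[OF K(1) adj(1)] arrow_if_rank_less[OF K(1) adj(2)] by linarith
  then obtain G H where G: "G \<in> amp_class G0" "c \<rightarrow>\<^bsub>G\<^esub> a" and H: "H \<in> amp_class G0" "b \<rightarrow>\<^bsub>H\<^esub> c"
  proof
    assume "c \<rightarrow>\<^bsub>K\<^esub> b"
    then obtain H where H: "H \<in> amp_class G0" "b \<rightarrow>\<^bsub>H\<^esub> c"
      using essential_line_reversible[OF cb K(1)] by blast
    then have "rank H a < rank H c" using rank_essential_arrow[OF ab H(1)] less by fastforce
    then have "a \<rightarrow>\<^bsub>H\<^esub> c" using arrow_if_rank_less[OF H(1) adj(2)] by simp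
    then show thesis using essential_line_reversible[OF ac H(1)] H that by blast
  next
    assume "a \<rightarrow>\<^bsub>K\<^esub> c"
    then obtain G where G: "G \<in> amp_class G0" "c \<rightarrow>\<^bsub>G\<^esub> a"
      using essential_line_reversible[OF ac K(1)] by blast
    then have "rank G c < rank G b" using rank_essential_arrow[OF ab G(1)] less by fastforce
    then have "c \<rightarrow>\<^bsub>G\<^esub> b" using arrow_if_rank_less[OF G(1) adj(1)] by simp
    then show thesis using essential_line_reversible[OF cb G(1)] G that by blast
  qed
  obtain G' where G': "G' \<in> finest G0" "c \<rightarrow>\<^bsub>G'\<^esub> a" using ex_finest[OF G(1)] G(2) by blast
  obtain H' where H': "H' \<in> finest G0" "b \<rightarrow>\<^bsub>H'\<^esub> c" using ex_finest[OF H(1)] H(2) by blast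
  have compelled: "a \<rightarrow>\<^bsub>D\<^esub> b" if "D \<in> finest G0" for D
  proof -
    have D: "D \<in> amp_class G0" "lines D \<subseteq> lines K"
      using that K(1) unfolding finest_def common_lines_def by auto
    have "\<not> a \<midarrow>\<^bsub>D\<^esub> b" using D(2) is_graphD(5)[OF amp_class_is_graph[OF K(1)] K(2)] by blast
    moreover have "\<not> b \<rightarrow>\<^bsub>D\<^esub> a" using ab D(1) essential_arrow by blast
    ultimately show ?thesis using essential_adjacent[OF D(1), of a b] adj(4) by (auto simp: adjacent_def)
  qed
  have mem: "G' \<in> amp_class G0" "H' \<in> amp_class G0" using G' H' by (auto simp: finest_def)
  interpret flip_closed_triangle "finest G0" "common_lines G0" a b c
    using finest_flip_closed compelled
    by (auto simp: flip_closed_triangle_def flip_closed_triangle_axioms_def)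
  have "c \<rightarrow>\<^bsub>G'\<^esub> b"
    using arrow_if_rank_less[OF mem(1) adj(1)] less[OF mem(1) G'(2)] less[OF mem(1) compelled[OF G'(1)]] by simp
  moreover have "a \<rightarrow>\<^bsub>H'\<^esub> c"
    using arrow_if_rank_less[OF mem(2) adj(2)] less[OF mem(2) H'(2)] less[OF mem(2) compelled[OF H'(1)]] by simp
  ultimately have "witness G' H'" using G' H' by (simp add: witness_def)
  then show False using no_witness by blast
qed

lemma essential_triangle:
  assumes ab: "a \<rightarrow>\<^bsub>essential_graph G0\<^esub> b" and bc: "(b, c) \<in> steps (essential_graph G0)"
    and ca: "(c, a) \<in> steps (essential_graph G0)"
  shows False
proof -
  obtain G where G: "G \<in> amp_class G0" "a \<rightarrow>\<^bsub>G\<^esub> b" using ab essential_arrow by blast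
  note less = amp_class_rank_less
  have adj: "adjacent (essential_graph G0) c b" "adjacent (essential_graph G0) a c"
    using bc ca by (auto simp: adjacent_def steps_def insert_commute)
  consider "b \<rightarrow>\<^bsub>essential_graph G0\<^esub> c" "c \<rightarrow>\<^bsub>essential_graph G0\<^esub> a"
    | "b \<rightarrow>\<^bsub>essential_graph G0\<^esub> c" "a \<midarrow>\<^bsub>essential_graph G0\<^esub> c"
    | "c \<midarrow>\<^bsub>essential_graph G0\<^esub> b" "c \<rightarrow>\<^bsub>essential_graph G0\<^esub> a"
    | "b \<midarrow>\<^bsub>essential_graph G0\<^esub> c" "c \<midarrow>\<^bsub>essential_graph G0\<^esub> a"
    using bc ca by (auto simp: steps_def insert_commute)
  then show False
  proof cases
    case 1
    then show False using less[OF G] rank_essential_arrow[OF _ G(1)] by (meson leD le_trans)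
  next
    case 2
    then have "rank G a < rank G c" using less[OF G] rank_essential_arrow[OF 2(1) G(1)] by simp
    then obtain H where H: "H \<in> amp_class G0" "c \<rightarrow>\<^bsub>H\<^esub> a"
      using essential_line_reversible[OF 2(2) G(1)] arrow_if_rank_less[OF G(1) adj(2)] by blast
    then show False
      using less[OF H] rank_essential_arrow[OF ab H(1)] rank_essential_arrow[OF 2(1) H(1)] by simp
  next
    case 3
    then have "rank G c < rank G b" using less[OF G] rank_essential_arrow[OF 3(2) G(1)] by simp
    then obtain H where H: "H \<in> amp_class G0" "b \<rightarrow>\<^bsub>H\<^esub> c"
      using essential_line_reversible[OF 3(1) G(1)] arrow_if_rank_less[OF G(1) adj(1)] by blast
    then show False
      using less[OF H] rank_essential_arrow[OF ab H(1)] rank_essential_arrow[OF 3(2) H(1)] by simp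
  next
    case 4
    then show False using essential_triangle_lines ab by blast
  qed
qed

text \<open>
  Otherwise \<open>G\<close> has the triplex \<open>x\<close>, \<open>y\<close>, \<open>z\<close> with \<open>z \<rightarrow> y\<close>, whereas some other member has \<open>y \<rightarrow> z\<close>.
\<close>

lemma unshielded_step:
  assumes G: "G \<in> amp_class G0" and xy: "(x, y) \<in> steps G"
    and yz: "(y, z) \<in> steps (essential_graph G0)"
    and xz: "x \<noteq> z" "\<not> adjacent (essential_graph G0) x z"
  shows "(y, z) \<in> steps G"
proof (rule ccontr)
  assume n: "(y, z) \<notin> steps G"
  have "adjacent G y z" using yz essential_adjacent[OF G, of y z] by (auto simp: steps_def adjacent_def)
  then have zy: "z \<rightarrow>\<^bsub>G\<^esub> y" using n by (auto simp: steps_def adjacent_def)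
  then have t: "triplex G x y z"
    using xy xz essential_adjacent[OF G] by (auto simp: triplex_def steps_def)
  have "z \<midarrow>\<^bsub>essential_graph G0\<^esub> y"
    using yz zy G essential_arrow by (auto simp: steps_def insert_commute)
  then obtain H where H: "H \<in> amp_class G0" "y \<rightarrow>\<^bsub>H\<^esub> z" using essential_line_reversible G zy by blast
  have "triplex H x y z" using t amp_class_eq(3)[OF H(1) G] by blast
  then show False
    using is_graphD(4,5)[OF amp_class_is_graph[OF H(1)] H(2)] unfolding triplex_def by blast
qed

text \<open>
  Among all arrows \<open>a \<rightarrow> b\<close> with a walk back from \<open>b\<close> to \<open>a\<close> choose one with the shortest walk. A
  forward chord shortens the walk, and a backward chord is an arrow with a shorter walk back.
\<close>

lemma essential_adicyclic: "adicyclic (essential_graph G0)"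
proof (rule adicyclicI, rule notI)
  define S where "S = steps (essential_graph G0)"
  define Q where "Q = (\<lambda>n. \<exists>a b. a \<rightarrow>\<^bsub>essential_graph G0\<^esub> b \<and> (b, a) \<in> S ^^ n)"
  fix a b assume "a \<rightarrow>\<^bsub>essential_graph G0\<^esub> b" "(b, a) \<in> (steps (essential_graph G0))\<^sup>*"
  then have ex: "\<exists>n. Q n" unfolding Q_def S_def rtrancl_power by blast
  define n where "n = (LEAST n. Q n)"
  have least: "n \<le> m" if "x \<rightarrow>\<^bsub>essential_graph G0\<^esub> y" "(y, x) \<in> S ^^ m" for m x y
    unfolding n_def using that by (intro Least_le) (auto simp: Q_def)
  have "Q n" unfolding n_def using ex by (rule LeastI_ex)
  then obtain a b p where ab: "a \<rightarrow>\<^bsub>essential_graph G0\<^esub> b"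
    and p: "p 0 = b" "p n = a" "\<And>i. i < n \<Longrightarrow> (p i, p (Suc i)) \<in> S"
    unfolding Q_def relpow_fun_conv by blast
  have sub: "(p i, p j) \<in> S ^^ (j - i)" if "i \<le> j" "j \<le> n" for i j
    unfolding relpow_fun_conv using that p(3) by (intro exI[of _ "\<lambda>k. p (i + k)"]) auto
  have short: "n \<le> i + m + (n - j)" if "(p i, p j) \<in> S ^^ m" "i \<le> n" "j \<le> n" for i j m
  proof -
    have "(b, p i) \<in> S ^^ i" "(p j, a) \<in> S ^^ (n - j)" using sub[of 0 i] sub[of j n] p that by auto
    then have "(b, a) \<in> S ^^ (i + m + (n - j))" using that(1) unfolding relpow_add by blast
    then show ?thesis using least ab by blast
  qed
  have n3: "3 \<le> n"
  proof (rule ccontr)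
    assume "\<not> 3 \<le> n"
    then consider "n = 0" | "n = 1" | "n = 2" by linarith
    then show False
    proof cases
      case 1
      then show False using p is_graphD(2)[OF essential_is_graph ab] by simp
    next
      case 2
      then have "(b, a) \<in> S" using p(3)[of 0] p by simp
      then show False
        using is_graphD(4,5)[OF essential_is_graph ab] by (auto simp: S_def steps_def insert_commute)
    next
      case 3
      then have "(b, p 1) \<in> S" "(p 1, a) \<in> S" using p(3)[of 0] p(3)[of 1] p by (auto simp: numeral_2_eq_2)
      then show False using essential_triangle[OF ab] unfolding S_def by blast
    qed
  qed
  have chordless: "\<not> adjacent (essential_graph G0) (p i) (p j)"
    if "i + 2 \<le> j" "j \<le> n" "i \<noteq> 0 \<or> j \<noteq> n" for i j
  proof
    assume "adjacent (essential_graph G0) (p i) (p j)"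
    then consider "(p i, p j) \<in> S ^^ 1" | "p j \<rightarrow>\<^bsub>essential_graph G0\<^esub> p i"
      by (auto simp: adjacent_def S_def steps_def)
    then show False
    proof cases
      case 1
      then show False using short[of i j 1] that by simp
    next
      case 2
      then show False using least[OF 2 sub[of i j]] that by auto
    qed
  qed
  have distinct: "p i \<noteq> p j" if "i < j" "j \<le> n" for i j
    using short[of i j 0] that by fastforce
  obtain G where G: "G \<in> amp_class G0" "a \<rightarrow>\<^bsub>G\<^esub> b" using ab essential_arrow by blast
  have walk: "(p i, p (Suc i)) \<in> steps G" if "i < n" for i
    using that
  proof (induction i)
    case 0
    have "(a, p 0) \<in> steps G" using G(2) p by (simp add: steps_def)
    moreover have "a \<noteq> p (Suc 0)" using distinct[of 1 n] n3 p by simp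
    moreover have "\<not> adjacent (essential_graph G0) a (p (Suc 0))"
      using chordless[of 1 n] n3 p adjacent_sym[of "essential_graph G0"] by simp
    ultimately show ?case using unshielded_step[OF G(1)] p(3)[OF 0] unfolding S_def by blast
  next
    case (Suc i)
    then have "(p i, p (Suc i)) \<in> steps G" by simp
    moreover have "p i \<noteq> p (Suc (Suc i))" using distinct[of i "Suc (Suc i)"] Suc.prems by simp
    moreover have "\<not> adjacent (essential_graph G0) (p i) (p (Suc (Suc i)))"
      using chordless[of i "Suc (Suc i)"] Suc.prems n3 by (cases i) auto
    ultimately show ?case using unshielded_step[OF G(1)] p(3)[OF Suc.prems] unfolding S_def by blast
  qed
  then have "(b, a) \<in> steps G ^^ n" unfolding relpow_fun_conv using p(1,2) by blast
  then show False using no_closed_walk[OF amp_class_chain_graph[OF G(1)] G(2)] by (meson relpow_imp_rtrancl)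
qed

end

theorem theorem3p2:
  fixes G0 :: "'a graph"
  assumes "chain_graph G0"
  shows "chain_graph (essential_graph G0) \<and> essential_graph G0 \<in> amp_class G0"
proof -
  have E: "chain_graph (essential_graph G0)"
    using essential_is_graph[OF assms] essential_adicyclic[OF assms] by (simp add: chain_graph_def)
  have "amp_equivalent (essential_graph G0) G0"
    using amp_equivalent_iff[OF essential_is_graph[OF assms] amp_class_is_graph[OF G0_mem[OF assms]]]
      essential_adjacent[OF assms G0_mem[OF assms]] essential_triplex[OF assms]
    by (simp add: essential_graph_def)
  then show ?thesis using E by (simp add: amp_class_def)
qed

end
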